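(* Let $\hat\Gamma=\arg\max_{\Gamma\succeq0}\mathcal{D}(\Gamma,\{X_i\}_{i=1}^n)$ (any positive semi-definite matrix attaining the deepest level). Assume $\epsilon<\tau/3$ and that the distribution $P_\Gamma=EC(0,\Gamma,\eta)$ satisfies the marginal condition with parameters $\tau,\alpha,\kappa$. Then, there exist absolute constants $C,C_1>0$, such that for any $\delta\in(0,1/2)$ satisfying $C_1\frac{p+\log(1/\delta)}{n}<1$, we have $$\|\hat\Gamma-\Gamma\|_{\rm op}^2\le C\kappa\left(\left(\frac pn\vee\epsilon^2\right)+\frac{\log(1/\delta)}{n}\right),$$ with $\mathbb{P}_{(\epsilon,\Gamma,Q)}$-probability at least $1-2\delta$ uniformly over all probability distributions $Q$ on $\mathbb{R}^p$ and all $\Gamma\in\mathcal{F}(M)$.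
   Context: Elliptical distributions: $X\sim EC(0,\Sigma,\xi)$ on $\mathbb{R}^p$ means $X=\xi AU$, where $A\in\mathbb{R}^{p\times r}$ is deterministic, $\Sigma=AA^T$, $U$ is uniform on the unit sphere of $\mathbb{R}^r$, and $\xi\ge0$ is a real random variable independent of $U$. If $s_{\min}(\Sigma)>0$ (non-degenerate), the law of $u^TX/\sqrt{u^T\Sigma u}$ does not depend on $u\in S^{p-1}=\{u\in\mathbb{R}^p:\|u\|=1\}$. For a non-degenerate $EC(0,\Sigma,\xi)$, $EC(0,\Gamma,\eta)$ is its canonical representation if and only if $\Gamma=a^{-2}\Sigma$ and $\eta=a\xi$ for some $a>0$, and $P_\Gamma\left(\frac{|u^TX|^2}{u^T\Gamma u}\le1\right)=\frac12$, where $P_\Gamma=EC(0,\Gamma,\eta)$; $\Gamma$ is called the scatter matrix. The notation $P_\Gamma=EC(0,\Gamma,\eta)$ always denotes the canonical representation. Marginal condition with parameters $\tau,\alpha,\kappa$: with $G(t)=P_\Gamma\left(\frac{|u^TX|^2}{u^T\Gamma u}\le t\right)$ (which does not depend on $u\in S^{p-1}$), $G$ is continuous at $t=1$, and for some $\tau\in(0,1/2)$ and $\alpha,\kappa>0$, $$\inf_{|t|\ge\alpha}|G(1)-G(1+t)|\ge\tau\quad\text{and}\quad\inf_{0<|t|<\alpha}\frac{|G(1)-G(1+t)|}{|t|}\ge\kappa^{-1/2}.$$ Contamination model: $\mathbb{P}_{(\epsilon,\Gamma,Q)}=(1-\epsilon)P_\Gamma+\epsilon Q$ with $Q$ an arbitrary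 probability distribution; $X_1,\dots,X_n$ are i.i.d. from it, and the same symbol denotes their joint law. $\mathcal{F}(M)=\{\Gamma=\Gamma^T\in\mathbb{R}^{p\times p}:\Gamma\succeq0,\ s_{\max}(\Gamma)\le M\}$, where $M>0$ is an absolute constant that does not scale with $p$ or $n$; $s_{\max},s_{\min}$ are the largest and smallest singular values. Empirical matrix depth: $$\mathcal{D}(\Gamma,\{X_i\}_{i=1}^n)=\min_{u\in S^{p-1}}\min\left\{\frac1n\sum_{i=1}^n\mathbb{I}\{|u^TX_i|^2\le u^T\Gamma u\},\ \frac1n\sum_{i=1}^n\mathbb{I}\{|u^TX_i|^2\ge u^T\Gamma u\}\right\}.$$ $\|\cdot\|_{\rm op}$ is the operator norm; $a\vee b=\max(a,b)$.
   Formalization: C_1 may depend on τ (C depends only on M): with p=1, ε=0 and τ far below n^{-1/2}, the rest of the mass at 0 and at a huge R, the sample median is near R with probability close to 1/2, so no C_1 independent of τ works. *)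

theory Defs
  imports "HOL-Probability.Probability" "Jordan_Normal_Form.Char_Poly"
begin

(* Dimensions are quantified inside the theorem, because its constants must not depend on them;
   vectors and matrices are therefore those of Jordan_Normal_Form with explicit carriers. *)

hide_const (open) Finite_Cartesian_Product.vec Finite_Cartesian_Product.transpose
hide_type (open) Finite_Cartesian_Product.vec
unbundle no inner_syntax
unbundle no vec_syntax

definition vnorm :: "real vec \<Rightarrow> real" where
  "vnorm v = sqrt (v \<bullet> v)"

definition unit_sphere :: "nat \<Rightarrow> real vec set" where
  "unit_sphere p = {u \<in> carrier_vec p. vnorm u = 1}"

definition op_norm :: "real mat \<Rightarrow> real" where
  "op_norm A = (SUP v\<in>unit_sphere (dim_col A). vnorm (A *\<^sub>v v))"

definition singular_values :: "real mat \<Rightarrow> real set" where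
  "singular_values A = {s. 0 \<le> s \<and> eigenvalue (transpose_mat A * A) (s\<^sup>2)}"

definition s_max :: "real mat \<Rightarrow> real" where
  "s_max A = Max (singular_values A)"

definition s_min :: "real mat \<Rightarrow> real" where
  "s_min A = Min (singular_values A)"

definition psd :: "nat \<Rightarrow> real mat \<Rightarrow> bool" where
  "psd p \<Gamma> \<longleftrightarrow> \<Gamma> \<in> carrier_mat p p \<and> \<Gamma> = transpose_mat \<Gamma> \<and>
     (\<forall>v\<in>carrier_vec p. 0 \<le> v \<bullet> (\<Gamma> *\<^sub>v v))"

definition cov_class :: "nat \<Rightarrow> real \<Rightarrow> real mat set" where
  "cov_class p M = {\<Gamma>. psd p \<Gamma> \<and> s_max \<Gamma> \<le> M}"

text \<open>The Borel sigma-algebra of \<open>\<real>\<^sup>p\<close>, generated by the coordinate maps.\<close>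

definition borel_vec :: "nat \<Rightarrow> real vec measure" where
  "borel_vec p = vimage_algebra (carrier_vec p) (\<lambda>v. \<lambda>i\<in>{..<p}. v $ i)
     (Pi\<^sub>M {..<p} (\<lambda>_. borel))"

text \<open>
  Normalised surface measure of the unit sphere (for \<open>r \<ge> 1\<close>): the mass of a set \<open>B\<close> is the
  proportion of the unit ball that lies in the cone over \<open>B\<close>, i.e. the measure is the law of
  \<open>z / |z|\<close> for \<open>z\<close> uniform in the ball. The centre is removed, as it has no direction.
\<close>

definition uniform_sphere :: "nat \<Rightarrow> real vec measure" where
  "uniform_sphere r =
     distr (uniform_measure (Pi\<^sub>M {..<r} (\<lambda>_. lborel))
              {z \<in> space (Pi\<^sub>M {..<r} (\<lambda>_. lborel)). 0 < vnorm (vec r z) \<and> vnorm (vec r z) \<le> 1})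
       (borel_vec r) (\<lambda>z. (1 / vnorm (vec r z)) \<cdot>\<^sub>v vec r z)"

text \<open>
  \<open>P = EC(0, \<Sigma>, \<xi>)\<close> on \<open>\<real>\<^sup>p\<close>, where the argument \<open>\<xi>\<close> is the law of the radial variable.
  Independence of the radial variable and \<open>U\<close> is the product measure.
\<close>

definition elliptical :: "nat \<Rightarrow> real vec measure \<Rightarrow> real mat \<Rightarrow> real measure \<Rightarrow> bool" where
  "elliptical p P \<Sigma> \<xi> \<longleftrightarrow>
     prob_space \<xi> \<and> sets \<xi> = sets borel \<and> (AE s in \<xi>. 0 \<le> s) \<and>
     (\<exists>r\<ge>1. \<exists>A\<in>carrier_mat p r. \<Sigma> = A * transpose_mat A \<and>
        P = distr (\<xi> \<Otimes>\<^sub>M uniform_sphere r) (borel_vec p) (\<lambda>(s, w). s \<cdot>\<^sub>v (A *\<^sub>v w)))"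

text \<open>
  Distribution function of \<open>|u\<^sup>T X|\<^sup>2 / u\<^sup>T \<Gamma> u\<close>. For a non-degenerate elliptical law it
  does not depend on the unit vector \<open>u\<close>, so conditions on it are stated for all \<open>u\<close>.
\<close>

definition G_fun :: "nat \<Rightarrow> real vec measure \<Rightarrow> real mat \<Rightarrow> real vec \<Rightarrow> real \<Rightarrow> real" where
  "G_fun p P \<Gamma> u t = measure P {x \<in> carrier_vec p. (u \<bullet> x)\<^sup>2 / (u \<bullet> (\<Gamma> *\<^sub>v u)) \<le> t}"

text \<open>\<open>P = EC(0, \<Gamma>, \<eta>)\<close> is the canonical representation of the non-degenerate
  \<open>EC(0, \<Sigma>, \<xi>)\<close>.\<close>

definition canonical_rep_of ::
    "nat \<Rightarrow> real vec measure \<Rightarrow> real mat \<Rightarrow> real measure \<Rightarrow> real mat \<Rightarrow> real measure \<Rightarrow> bool" where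
  "canonical_rep_of p P \<Gamma> \<eta> \<Sigma> \<xi> \<longleftrightarrow>
     elliptical p P \<Sigma> \<xi> \<and> 0 < s_min \<Sigma> \<and> elliptical p P \<Gamma> \<eta> \<and>
     (\<exists>a>0. \<Gamma> = (1 / a\<^sup>2) \<cdot>\<^sub>m \<Sigma> \<and> \<eta> = distr \<xi> borel (\<lambda>s. a * s)) \<and>
     (\<forall>u\<in>unit_sphere p. G_fun p P \<Gamma> u 1 = 1 / 2)"

definition canonical_EC :: "nat \<Rightarrow> real vec measure \<Rightarrow> real mat \<Rightarrow> real measure \<Rightarrow> bool" where
  "canonical_EC p P \<Gamma> \<eta> \<longleftrightarrow> (\<exists>\<Sigma> \<xi>. canonical_rep_of p P \<Gamma> \<eta> \<Sigma> \<xi>)"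

definition marginal_condition ::
    "nat \<Rightarrow> real vec measure \<Rightarrow> real mat \<Rightarrow> real \<Rightarrow> real \<Rightarrow> real \<Rightarrow> bool" where
  "marginal_condition p P \<Gamma> \<tau> \<alpha> \<kappa> \<longleftrightarrow>
     0 < \<tau> \<and> \<tau> < 1 / 2 \<and> 0 < \<alpha> \<and> 0 < \<kappa> \<and>
     (\<forall>u\<in>unit_sphere p. let G = G_fun p P \<Gamma> u in
        isCont G 1 \<and>
        \<tau> \<le> (INF t\<in>{t. \<alpha> \<le> \<bar>t\<bar>}. \<bar>G 1 - G (1 + t)\<bar>) \<and>
        \<kappa> powr (- 1 / 2) \<le> (INF t\<in>{t. 0 < \<bar>t\<bar> \<and> \<bar>t\<bar> < \<alpha>}. \<bar>G 1 - G (1 + t)\<bar> / \<bar>t\<bar>))"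

definition contaminated :: "real \<Rightarrow> 'a measure \<Rightarrow> 'a measure \<Rightarrow> 'a measure" where
  "contaminated \<epsilon> P Q = measure_of (space P) (sets P)
     (\<lambda>B. ennreal (1 - \<epsilon>) * emeasure P B + ennreal \<epsilon> * emeasure Q B)"

definition iid_law :: "nat \<Rightarrow> 'a measure \<Rightarrow> (nat \<Rightarrow> 'a) measure" where
  "iid_law n P = Pi\<^sub>M {..<n} (\<lambda>_. P)"

text \<open>
  For every \<open>n\<close> the depth only takes values in the finite set of multiples of \<open>1 / n\<close> in
  \<open>[0, 1]\<close>, so for \<open>p \<ge> 1\<close> the infimum over the sphere is a minimum and maximisers exist.
\<close>

definition matrix_depth :: "nat \<Rightarrow> nat \<Rightarrow> (nat \<Rightarrow> real vec) \<Rightarrow> real mat \<Rightarrow> real" where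
  "matrix_depth p n X \<Gamma> =
     (INF u\<in>unit_sphere p.
        min ((\<Sum>i<n. of_bool ((u \<bullet> X i)\<^sup>2 \<le> u \<bullet> (\<Gamma> *\<^sub>v u))) / real n)
            ((\<Sum>i<n. of_bool ((u \<bullet> X i)\<^sup>2 \<ge> u \<bullet> (\<Gamma> *\<^sub>v u))) / real n))"

definition deepest_estimator ::
    "nat \<Rightarrow> nat \<Rightarrow> ((nat \<Rightarrow> real vec) \<Rightarrow> real mat) \<Rightarrow> bool" where
  "deepest_estimator p n Gh \<longleftrightarrow>
     (\<forall>X. (\<forall>i<n. X i \<in> carrier_vec p) \<longrightarrow> is_arg_max (matrix_depth p n X) (psd p) (Gh X))"

text \<open>
  An arbitrary selection of a maximiser need not be a measurable function of the data, so
  ``with probability at least \<open>c\<close>'' is read as inner probability: the event contains a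
  measurable event of probability at least \<open>c\<close>.
\<close>

definition with_prob_at_least :: "'a measure \<Rightarrow> real \<Rightarrow> ('a \<Rightarrow> bool) \<Rightarrow> bool" where
  "with_prob_at_least N c \<phi> \<longleftrightarrow> (\<exists>E\<in>sets N. c \<le> measure N E \<and> (\<forall>x\<in>E. \<phi> x))"

end

theory Submission
  imports Defs
begin

text \<open>
  Let \<open>\<Delta>\<close> be the largest difference, over all half-spaces, between
  empirical frequency and probability under the contaminated law. A slab \<open>{x. (u\<^sup>T x)\<^sup>2 \<le> q}\<close>, and its
  counterpart with the inequality reversed, has an indicator that is a sum of two half-space
  indicators up to a constant, so its frequency is within \<open>2\<Delta>\<close> of its probability. The true
  scatter matrix \<open>\<Gamma>\<close> splits every direction at the median, hence has depth at least \<open>(1 - \<epsilon>)/2 - 2\<Delta>\<close>, and the deepest matrix \<open>Gh\<close> is at least as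
  deep. Going back from frequencies to the uncontaminated law, \<open>u\<^sup>T Gh u\<close> is, for every unit \<open>u\<close>, a
  \<open>\<beta>\<close>-approximate median of \<open>(u\<^sup>T x)\<^sup>2\<close> with \<open>\<beta> = (4\<Delta> + \<epsilon>)/(1 - \<epsilon>)\<close>. The marginal condition forbids
  approximate medians with \<open>\<beta> < \<tau>\<close> to be far from the median, and near the median it turns
  \<open>\<beta>\<close> into the relative error \<open>\<beta> \<kappa>\<^sup>1\<^sup>/\<^sup>2\<close>. As \<open>u\<^sup>T \<Gamma> u \<le> M\<close>, the quadratic form of \<open>Gh - \<Gamma>\<close> is bounded by
  \<open>M \<beta> \<kappa>\<^sup>1\<^sup>/\<^sup>2\<close> on the sphere, and for a symmetric matrix this is a bound on the operator norm. This part is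
  \<open>scatter_error_from_depth\<close>.

  The probabilistic input is \<open>\<Delta> = O(((p + log (1/\<delta>))/n)\<^sup>1\<^sup>/\<^sup>2)\<close> with probability \<open>1 - 2\<delta>\<close>, without a
  logarithmic factor in front of \<open>p\<close>. It is proved for every countable class of sets of finite VC
  dimension \<open>D\<close> (\<open>vc_uniform_deviation\<close>). A ghost sample and random swaps reduce it to a
  count of sign vectors for a fixed sample of \<open>2n\<close> points (\<open>prob_deviation_event_le_swap\<close>,
  \<open>prob_swap_event_le\<close>). There, Sauer's bound and a random subsample show that a family of traces
  with pairwise distance \<open>\<eta>\<close> has at most \<open>(4/\<eta>)\<^sup>2\<^sup>D\<close> members, up to a constant factor
  (\<open>card_separated_family_le\<close>). Chaining along nets at scales \<open>4\<^sup>-\<^sup>k\<close> with Hoeffding's bound for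
  the increments (\<open>rademacher_chaining\<close>) sums the contributions of all scales to a convergent series
  of order \<open>(n (D + log (1/\<delta>)))\<^sup>1\<^sup>/\<^sup>2\<close>, which is why no logarithm of \<open>n\<close> survives.

  The good event concerns only half-spaces with rational parameters, hence is measurable. Every
  half-space is a pointwise limit of those, so the bound extends to all of them on that event.
\<close>

section \<open>Classes of finite VC dimension\<close>

definition shatters :: "'a set set \<Rightarrow> 'a set \<Rightarrow> bool" where
  "shatters F S \<longleftrightarrow> (\<forall>B\<subseteq>S. \<exists>A\<in>F. S \<inter> A = B)"

lemma shattersD: "shatters F S \<Longrightarrow> B \<subseteq> S \<Longrightarrow> \<exists>A\<in>F. S \<inter> A = B"
  by (simp add: shatters_def)

definition vc_dim_le :: "nat \<Rightarrow> 'a set set \<Rightarrow> bool" where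
  "vc_dim_le D F \<longleftrightarrow> (\<forall>S. finite S \<and> shatters F S \<longrightarrow> card S \<le> D)"

lemma vc_dim_le_subset: "vc_dim_le D F \<Longrightarrow> F' \<subseteq> F \<Longrightarrow> vc_dim_le D F'"
  unfolding vc_dim_le_def shatters_def by (meson subsetD)

text \<open>
  If two points of \<open>S\<close> had the same image, no preimage could separate them; so \<open>x\<close> is injective on
  a set shattered by preimages, and its image is shattered by the class itself.
\<close>

lemma vc_dim_le_vimage:
  assumes "vc_dim_le D F"
  shows "vc_dim_le D ((\<lambda>A. x -` A) ` F)"
  unfolding vc_dim_le_def
proof (intro allI impI, elim conjE)
  fix S :: "'b set"
  assume S: "finite S" and sh: "shatters ((\<lambda>A. x -` A) ` F) S"
  have inj: "inj_on x S"
  proof (rule inj_onI)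
    fix a b assume ab: "a \<in> S" "b \<in> S" "x a = x b"
    then have "\<exists>A\<in>(\<lambda>A. x -` A) ` F. S \<inter> A = {a}"
      using sh unfolding shatters_def by auto
    then obtain A where A: "S \<inter> x -` A = {a}" by auto
    then have "a \<in> S \<inter> x -` A" by simp
    then have "b \<in> S \<inter> x -` A" using ab by simp
    then show "a = b" using A by simp
  qed
  have "shatters F (x ` S)"
    unfolding shatters_def
  proof (intro allI impI)
    fix B assume B: "B \<subseteq> x ` S"
    have "\<exists>A\<in>(\<lambda>A. x -` A) ` F. S \<inter> A = S \<inter> x -` B"
      using sh unfolding shatters_def by auto
    then obtain A where "A \<in> F" "S \<inter> x -` A = S \<inter> x -` B" by auto
    then have "x ` S \<inter> A = B" using B by blast
    with \<open>A \<in> F\<close> show "\<exists>A\<in>F. x ` S \<inter> A = B" by blast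
  qed
  then have "card (x ` S) \<le> D"
    using assms S unfolding vc_dim_le_def by auto
  then show "card S \<le> D" using card_image[OF inj] by simp
qed

lemma vc_dim_le_traces:
  assumes "vc_dim_le D F"
  shows "vc_dim_le D ((\<inter>) J ` F)"
  unfolding vc_dim_le_def
proof (intro allI impI, elim conjE)
  fix S assume S: "finite S" and sh: "shatters ((\<inter>) J ` F) S"
  from sh have "\<exists>A\<in>(\<inter>) J ` F. S \<inter> A = S" unfolding shatters_def by blast
  then have "S \<subseteq> J" by auto
  then have "shatters F S"
    using sh unfolding shatters_def by (auto simp: Int_assoc[symmetric] Int_absorb2)
  then show "card S \<le> D" using assms S unfolding vc_dim_le_def by auto
qed

text \<open>
  Pajor's form of the Sauer-Shelah lemma. Adding a point \<open>x\<close> to \<open>I\<close> creates one new trace for each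
  trace on \<open>I\<close> that extends both with and without \<open>x\<close>. The family of these doubly extendable traces
  shatters a set \<open>S\<close> only if \<open>F\<close> shatters \<open>insert x S\<close>, so the induction hypothesis for that family counts
  exactly the shattered sets that contain \<open>x\<close>.
\<close>

lemma card_traces_le_card_shattered:
  assumes "finite I"
  shows "card ((\<inter>) I ` F) \<le> card {S. S \<subseteq> I \<and> shatters F S}"
  using assms
proof (induction I arbitrary: F rule: finite_induct)
  case empty
  show ?case
  proof (cases "F = {}")
    case False
    then have "{S. S \<subseteq> {} \<and> shatters F S} = {{}}" by (auto simp: shatters_def)
    moreover have "(\<inter>) {} ` F = {{}}" using False by auto
    ultimately show ?thesis by simp
  qed simp
next
  case (insert x I)
  define T where "T = (\<inter>) (insert x I) ` F"
  define T1 where "T1 = {B\<in>T. x \<notin> B}"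
  define T2 where "T2 = {B\<in>T. x \<in> B}"
  define T2' where "T2' = (\<lambda>B. B - {x}) ` T2"
  have TP: "T \<subseteq> Pow (insert x I)" by (auto simp: T_def)
  have finT: "finite T" by (rule finite_subset[OF TP]) (simp add: insert.hyps)
  then have fin: "finite T1" "finite T2" "finite T2'" by (auto simp: T1_def T2_def T2'_def)
  have inj: "inj_on (\<lambda>B. B - {x}) T2" by (rule inj_onI) (auto simp: T2_def)
  have "card T = card T1 + card T2"
    using fin by (subst card_Un_disjoint[symmetric]) (auto simp: T1_def T2_def intro!: arg_cong[where f = card])
  also have "card T2 = card T2'" unfolding T2'_def using card_image[OF inj] by simp
  also have "card T1 + card T2' = card (T1 \<union> T2') + card (T1 \<inter> T2')"
    using fin card_Un_Int by blast
  also have "T1 \<union> T2' = (\<inter>) I ` F"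
  proof (intro equalityI subsetI)
    fix B assume "B \<in> T1 \<union> T2'"
    then obtain A where "A \<in> F" "B = I \<inter> A"
      using insert.hyps unfolding T1_def T2'_def T2_def T_def by auto
    then show "B \<in> (\<inter>) I ` F" by auto
  next
    fix B assume "B \<in> (\<inter>) I ` F"
    then obtain A where A: "A \<in> F" "B = I \<inter> A" by auto
    show "B \<in> T1 \<union> T2'"
    proof (cases "x \<in> A")
      case True
      then have "insert x I \<inter> A \<in> T2" using A unfolding T2_def T_def by auto
      moreover have "B = insert x I \<inter> A - {x}" using A insert.hyps by auto
      ultimately show ?thesis unfolding T2'_def by blast
    next
      case False
      then have "B \<in> T1" using A insert.hyps unfolding T1_def T_def by auto
      then show ?thesis by simp
    qed
  qed
  also have "card \<dots> \<le> card {S. S \<subseteq> I \<and> shatters F S}" by (rule insert.IH)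
  finally have 1: "card T \<le> card {S. S \<subseteq> I \<and> shatters F S} + card (T1 \<inter> T2')" by simp
  let ?F2 = "T1 \<inter> T2'"
  have F2: "(\<inter>) I ` ?F2 = ?F2"
  proof -
    have "I \<inter> B = B" if "B \<in> ?F2" for B
      using that TP unfolding T1_def by auto
    then show ?thesis by (auto simp: image_def)
  qed
  have "card ?F2 \<le> card {S. S \<subseteq> I \<and> shatters ?F2 S}"
    using insert.IH[of ?F2] F2 by simp
  also have "\<dots> \<le> card {S. S \<subseteq> insert x I \<and> x \<in> S \<and> shatters F S}"
  proof (rule card_inj_on_le[where f = "insert x"])
    show "inj_on (insert x) {S. S \<subseteq> I \<and> shatters ?F2 S}"
      using insert.hyps by (intro inj_onI) (auto simp: insert_ident subset_eq)
    show "finite {S. S \<subseteq> insert x I \<and> x \<in> S \<and> shatters F S}"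
      by (rule finite_subset[of _ "Pow (insert x I)"]) (auto simp: insert.hyps)
    show "insert x ` {S. S \<subseteq> I \<and> shatters ?F2 S} \<subseteq> {S. S \<subseteq> insert x I \<and> x \<in> S \<and> shatters F S}"
    proof safe
      fix S assume S: "S \<subseteq> I" and sh: "shatters ?F2 S"
      show "shatters F (insert x S)" unfolding shatters_def
      proof (intro allI impI)
        fix B assume B: "B \<subseteq> insert x S"
        have "B - {x} \<subseteq> S" using B by auto
        then obtain C where C: "C \<in> T1" "C \<in> T2'" "S \<inter> C = B - {x}"
          using sh unfolding shatters_def by (meson IntD1 IntD2)
        show "\<exists>A\<in>F. insert x S \<inter> A = B"
        proof (cases "x \<in> B")
          case True
          from C obtain A where A: "A \<in> F" "x \<in> A" "C = insert x I \<inter> A - {x}"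
            unfolding T2'_def T2_def T_def by auto
          have "insert x S \<inter> A = B"
          proof -
            have "S \<inter> A - {x} = B - {x}" using C(3) A S by auto
            then show ?thesis using True A B by auto
          qed
          with A show ?thesis by blast
        next
          case False
          from C obtain A where A: "A \<in> F" "x \<notin> A" "C = insert x I \<inter> A"
            unfolding T1_def T_def by auto
          have "insert x S \<inter> A = B" using A C S False by auto
          with A show ?thesis by blast
        qed
      qed
    qed auto
  qed
  finally have "card T \<le> card {S. S \<subseteq> I \<and> shatters F S}
      + card {S. S \<subseteq> insert x I \<and> x \<in> S \<and> shatters F S}" using 1 by simp
  also have "\<dots> = card {S. S \<subseteq> insert x I \<and> shatters F S}"
    using insert.hyps
    by (subst card_Un_disjoint[symmetric])
       (auto intro!: arg_cong[where f = card] intro: finite_subset[of _ "Pow (insert x I)"])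
  finally show ?case unfolding T_def .
qed

text \<open>
  Sauer's bound with a free parameter. Give each subset \<open>S\<close> of \<open>I\<close> the weight \<open>x ^ card S / x ^ D\<close>: it is at
  least 1 if \<open>card S \<le> D\<close>, and all weights together sum to \<open>(1 + x) ^ card I / x ^ D\<close>. Leaving \<open>x\<close> free
  makes the later optimisation a one-line estimate and avoids the case distinction between
  \<open>card I\<close> and \<open>D\<close>.
\<close>

lemma card_traces_le_exp:
  fixes x :: real
  assumes "vc_dim_le D F" "finite I" "0 < x" "x \<le> 1"
  shows "real (card ((\<inter>) I ` F)) \<le> (1 / x) ^ D * exp (x * card I)"
proof -
  have finP: "finite (Pow I)" using assms by simp
  have "real (card ((\<inter>) I ` F)) \<le> real (card {S. S \<subseteq> I \<and> shatters F S})"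
    using card_traces_le_card_shattered[OF assms(2)] by simp
  also have "\<dots> \<le> real (card {S\<in>Pow I. card S \<le> D})"
    using assms finite_subset[of _ I]
    by (intro of_nat_mono card_mono) (auto simp: vc_dim_le_def)
  also have "\<dots> = (\<Sum>S\<in>{S\<in>Pow I. card S \<le> D}. 1)" by simp
  also have "\<dots> \<le> (\<Sum>S\<in>{S\<in>Pow I. card S \<le> D}. (1 / x) ^ D * x ^ card S)"
  proof (rule sum_mono)
    fix S assume "S \<in> {S\<in>Pow I. card S \<le> D}"
    then have "x ^ D \<le> x ^ card S" using assms by (intro power_decreasing) auto
    then show "1 \<le> (1 / x) ^ D * x ^ card S" using assms by (simp add: power_one_over field_simps)
  qed
  also have "\<dots> \<le> (\<Sum>S\<in>Pow I. (1 / x) ^ D * x ^ card S)"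
    using assms by (intro sum_mono2) auto
  also have "\<dots> = (1 / x) ^ D * (1 + x) ^ card I"
    using prod_add[OF assms(2), of "\<lambda>_. x" "\<lambda>_. 1::real"]
    by (simp add: sum_distrib_left[symmetric] add.commute)
  also have "(1 + x) ^ card I \<le> exp x ^ card I"
    using assms by (intro power_mono exp_ge_add_one_self) auto
  finally show ?thesis
    using assms by (simp add: exp_of_nat_mult[symmetric] mult.commute)
qed

text \<open>
  Draw \<open>l\<close> points of \<open>J\<close> independently and uniformly, here by counting all \<open>l\<close>-tuples. A pair of sets at
  relative distance \<open>\<eta>\<close> is left undistinguished by a fraction at most \<open>e\<^sup>-\<^sup>\<eta>\<^sup>l\<close> of the tuples; with
  \<open>l\<close> of size \<open>2 ln N / \<eta>\<close> some tuple distinguishes all \<open>N\<close> sets at once, so \<open>N\<close> is at most a number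
  of traces on \<open>l\<close> points. In Sauer's bound \<open>x = \<eta>/4\<close> makes the term \<open>x l\<close> absorb only half of \<open>ln N\<close>.
\<close>

lemma card_separated_family_le:
  fixes T :: "'a set set" and \<eta> :: real
  assumes J: "finite J" "J \<noteq> {}" and T: "finite T" "T \<noteq> {}" and vc: "vc_dim_le D T"
    and \<eta>: "0 < \<eta>" "\<eta> \<le> 1"
    and sep: "\<And>A B. A \<in> T \<Longrightarrow> B \<in> T \<Longrightarrow> A \<noteq> B \<Longrightarrow> \<eta> * card J \<le> card (J \<inter> (A - B \<union> (B - A)))"
  shows "ln (card T) \<le> 2 * real D * ln (4 / \<eta>) + 1 / 2"
proof -
  define N where "N = card T"
  define m where "m = card J"
  have N: "N \<ge> 1" using T by (simp add: N_def Suc_le_eq card_gt_0_iff)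
  have m: "m \<ge> 1" using J by (simp add: m_def Suc_le_eq card_gt_0_iff)
  \<comment> \<open>With this many points the union bound over all pairs leaves a positive fraction of tuples.\<close>
  define l where "l = nat \<lceil>2 * ln N / \<eta>\<rceil>"
  have lnN: "ln N \<ge> 0" using N by simp
  have l1: "2 * ln N / \<eta> \<le> l" unfolding l_def by linarith
  have "real l \<le> max 0 (2 * ln N / \<eta> + 1)" unfolding l_def by linarith
  then have l2: "real l \<le> 2 * ln N / \<eta> + 1" using lnN \<eta> by simp
  define \<Omega> where "\<Omega> = PiE {..<l} (\<lambda>_. J)"
  define bad where "bad = (\<lambda>(A,B). PiE {..<l} (\<lambda>_. J - (A - B \<union> (B - A))))"
  define pairs where "pairs = {(A,B). A \<in> T \<and> B \<in> T \<and> A \<noteq> B}"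
  have finp: "finite pairs" unfolding pairs_def
    by (rule finite_subset[of _ "T \<times> T"]) (use T in auto)
  have "pairs \<union> (\<lambda>A. (A,A)) ` T = T \<times> T" by (auto simp: pairs_def)
  moreover have "card (pairs \<union> (\<lambda>A. (A,A)) ` T) = card pairs + card ((\<lambda>A. (A,A)) ` T)"
    using finp T by (intro card_Un_disjoint) (auto simp: pairs_def)
  moreover have "card ((\<lambda>A. (A,A)) ` T) = N"
    unfolding N_def by (intro card_image inj_onI) auto
  ultimately have cp: "card pairs + N = N * N"
    unfolding N_def by (simp add: card_cartesian_product)
  have cbad: "real (card (bad q)) \<le> real m ^ l / (real N)\<^sup>2" if qp: "q \<in> pairs" for q
  proof -
    obtain A B where q: "q = (A,B)" "A \<in> T" "B \<in> T" "A \<noteq> B"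
      using qp unfolding pairs_def by blast
    have "card (J - (A - B \<union> (B - A))) = m - card (J \<inter> (A - B \<union> (B - A)))"
      unfolding m_def using J by (simp add: card_Diff_subset_Int)
    moreover have "card (J \<inter> (A - B \<union> (B - A))) \<le> m"
      unfolding m_def using J by (intro card_mono) auto
    ultimately have "real (card (J - (A - B \<union> (B - A)))) \<le> m - \<eta> * m"
      using sep[OF q(2-4)] by (simp add: m_def of_nat_diff)
    also have "\<dots> = m * (1 - \<eta>)" by (simp add: algebra_simps)
    also have "\<dots> \<le> m * exp (- \<eta>)"
      using exp_ge_add_one_self[of "- \<eta>"] by (intro mult_left_mono) auto
    finally have "real (card (J - (A - B \<union> (B - A)))) ^ l \<le> (m * exp (- \<eta>)) ^ l"
      by (intro power_mono) auto
    also have "\<dots> = real m ^ l * exp (- (\<eta> * l))"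
      by (simp add: power_mult_distrib exp_of_nat_mult[symmetric] mult.commute)
    also have "\<dots> \<le> real m ^ l * exp (- (2 * ln N))"
      using l1 \<eta> by (intro mult_left_mono) (auto simp: field_simps)
    also have "exp (- (2 * ln N)) = 1 / (real N)\<^sup>2"
      using N by (simp add: exp_minus exp_double field_simps)
    finally have "real (card (J - (A - B \<union> (B - A)))) ^ l \<le> real m ^ l / (real N)\<^sup>2" by simp
    moreover have "card (bad q) = card (J - (A - B \<union> (B - A))) ^ l"
      using q by (simp add: bad_def card_PiE)
    ultimately show ?thesis by simp
  qed
  have c\<Omega>: "card \<Omega> = m ^ l" by (simp add: \<Omega>_def card_PiE m_def)
  have "real (card (\<Union>q\<in>pairs. bad q)) \<le> (\<Sum>q\<in>pairs. real (card (bad q)))"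
    using card_UN_le[OF finp, of bad] by (simp flip: of_nat_sum)
  also have "\<dots> \<le> card pairs * (real m ^ l / (real N)\<^sup>2)"
    using sum_bounded_above[of pairs "\<lambda>q. real (card (bad q))", OF cbad] by simp
  also have "\<dots> < real m ^ l"
  proof -
    have "real (card pairs) = (real N)\<^sup>2 - N"
      using cp by (metis add_diff_cancel_right' of_nat_add of_nat_mult power2_eq_square)
    then have "real (card pairs) < (real N)\<^sup>2" using N by simp
    then show ?thesis using m N by (simp add: field_simps)
  qed
  finally have "card (\<Union>q\<in>pairs. bad q) < card \<Omega>" by (simp add: c\<Omega> flip: of_nat_power)
  then have "\<not> \<Omega> \<subseteq> (\<Union>q\<in>pairs. bad q)"
    using card_mono[of "\<Union>q\<in>pairs. bad q" \<Omega>] finp J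
    by (force simp: bad_def intro!: finite_PiE)
  then obtain j where j: "j \<in> \<Omega>" "\<And>q. q \<in> pairs \<Longrightarrow> j \<notin> bad q" by blast
  have inj: "inj_on (\<lambda>A. {..<l} \<inter> j -` A) T"
  proof (rule inj_onI, rule ccontr)
    fix A B assume AB: "A \<in> T" "B \<in> T" "{..<l} \<inter> j -` A = {..<l} \<inter> j -` B" "A \<noteq> B"
    then have "j \<notin> bad (A,B)" using j(2)[of "(A,B)"] by (auto simp: pairs_def)
    with j(1) obtain i where "i < l" "j i \<in> A - B \<union> (B - A)"
      by (auto simp: bad_def \<Omega>_def PiE_iff)
    with AB(3) show False by (auto simp: set_eq_iff)
  qed
  have "N = card ((\<lambda>A. {..<l} \<inter> j -` A) ` T)" unfolding N_def using card_image[OF inj] by simp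
  also have "(\<lambda>A. {..<l} \<inter> j -` A) ` T = (\<inter>) {..<l} ` ((\<lambda>A. j -` A) ` T)" by (simp add: image_image)
  finally have "real N \<le> (1 / (\<eta> / 4)) ^ D * exp (\<eta> / 4 * card {..<l})"
    using card_traces_le_exp[OF vc_dim_le_vimage[OF vc, of j], of "{..<l}" "\<eta> / 4"] \<eta> by simp
  then have "ln N \<le> ln ((4 / \<eta>) ^ D * exp (\<eta> / 4 * l))"
    using N by (subst ln_le_cancel_iff) (auto simp: \<eta>)
  also have "\<dots> = D * ln (4 / \<eta>) + \<eta> / 4 * l"
    using \<eta> by (simp add: ln_mult ln_realpow)
  also have "\<dots> \<le> D * ln (4 / \<eta>) + (ln N / 2 + \<eta> / 4)"
  proof -
    have "\<eta> / 4 * l \<le> \<eta> / 4 * (2 * ln N / \<eta> + 1)" using l2 \<eta> by (intro mult_left_mono) auto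
    also have "\<dots> = ln N / 2 + \<eta> / 4" using \<eta> by (simp add: distrib_left)
    finally show ?thesis by simp
  qed
  finally show ?thesis using \<eta> unfolding N_def by simp
qed

lemma finite_maximal_separated_subset:
  fixes d :: "'b \<Rightarrow> 'b \<Rightarrow> real"
  assumes "finite T" "\<And>A B. d A B = d B A" "\<And>A. d A A \<le> r"
  shows "\<exists>T'\<subseteq>T. (\<forall>A\<in>T'. \<forall>B\<in>T'. A \<noteq> B \<longrightarrow> r < d A B) \<and> (\<forall>A\<in>T. \<exists>B\<in>T'. d A B \<le> r)"
  using assms(1)
proof (induction T rule: finite_induct)
  case (insert x T)
  then obtain T' where T': "T' \<subseteq> T" "\<forall>A\<in>T'. \<forall>B\<in>T'. A \<noteq> B \<longrightarrow> r < d A B"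
    "\<forall>A\<in>T. \<exists>B\<in>T'. d A B \<le> r" by blast
  show ?case
  proof (cases "\<exists>B\<in>T'. d x B \<le> r")
    case True
    with T' show ?thesis by (intro exI[of _ T']) auto
  next
    case False
    with T' assms(2,3) show ?thesis
      by (intro exI[of _ "insert x T'"]) (auto simp: not_le)
  qed
qed simp

section \<open>Chaining for random signs\<close>

text \<open>
  The moment generating function of a fair sign, \<open>cosh x \<le> exp (x\<^sup>2/2)\<close>. It is the bound behind Hoeffding's lemma
  for a fair coin with values 0 and \<open>2x\<close>, shifted by \<open>x\<close>.
\<close>

lemma exp_plus_exp_uminus_le: "exp x + exp (- x) \<le> 2 * exp (x\<^sup>2 / 2)" for x :: real
proof -
  have *: "exp x + exp (- x) \<le> 2 * exp (x\<^sup>2 / 2)" if "x \<ge> 0" for x :: real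
  proof -
    have pos: "exp (2 * x) + 1 > (0::real)" by (simp add: add_pos_pos)
    have eq: "1 + 1 / 2 * (exp (2 * x) - 1) = (exp (2 * x) + 1) / 2" by (simp add: field_simps)
    have "- (2 * x) * (1 / 2) + ln (1 + 1 / 2 * (exp (2 * x) - 1)) \<le> (2 * x)\<^sup>2 / 8"
      using that by (intro Hoeffdings_lemma_aux) auto
    then have "ln ((exp (2 * x) + 1) / 2) \<le> x + x\<^sup>2 / 2"
      unfolding eq by (simp add: power_mult_distrib)
    then have "exp (ln ((exp (2 * x) + 1) / 2)) \<le> exp (x + x\<^sup>2 / 2)" by simp
    then have "(exp (2 * x) + 1) / 2 \<le> exp (x + x\<^sup>2 / 2)" using pos by (subst (asm) exp_ln) auto
    then have "exp (- x) * (exp (2 * x) + 1) \<le> exp (- x) * (2 * exp (x + x\<^sup>2 / 2))"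
      by (intro mult_left_mono) auto
    then show ?thesis by (simp add: algebra_simps flip: exp_add)
  qed
  show ?thesis using *[of x] *[of "- x"] by (cases "x \<ge> 0") (auto simp: add.commute)
qed

text \<open>
  A sign vector is represented by the set of its positive coordinates, so that averaging over random
  signs becomes counting in \<open>Pow {..<n}\<close>.
\<close>

definition rsign :: "nat set \<Rightarrow> nat \<Rightarrow> real" where
  "rsign s i = (if i \<in> s then 1 else - 1)"

lemma rademacher_tail_one_sided:
  fixes a :: "nat \<Rightarrow> real"
  assumes I: "finite I" and v: "(\<Sum>i\<in>I. (a i)\<^sup>2) \<le> v" "0 < v" and t: "0 \<le> t"
  shows "real (card {s\<in>Pow I. t < (\<Sum>i\<in>I. rsign s i * a i)}) \<le> 2 ^ card I * exp (- (t\<^sup>2 / (2 * v)))"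
proof -
  define l where "l = t / v"
  have l: "l \<ge> 0" using t v by (simp add: l_def)
  let ?S = "\<lambda>s. \<Sum>i\<in>I. rsign s i * a i"
  let ?X = "{s\<in>Pow I. t < ?S s}"
  have fin: "finite (Pow I)" using I by simp
  have "(\<Sum>s\<in>Pow I. exp (l * ?S s)) = (\<Sum>s\<in>Pow I. (\<Prod>i\<in>s. exp (l * a i)) * (\<Prod>i\<in>I - s. exp (- (l * a i))))"
  proof (rule sum.cong[OF refl])
    fix s assume s: "s \<in> Pow I"
    then have fs: "finite s" using I finite_subset by blast
    have "?S s = (\<Sum>i\<in>I - s. rsign s i * a i) + (\<Sum>i\<in>s. rsign s i * a i)"
      using s I by (intro sum.subset_diff) auto
    also have "(\<Sum>i\<in>I - s. rsign s i * a i) = (\<Sum>i\<in>I - s. - a i)"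
      by (intro sum.cong) (auto simp: rsign_def)
    also have "(\<Sum>i\<in>s. rsign s i * a i) = (\<Sum>i\<in>s. a i)"
      by (intro sum.cong) (auto simp: rsign_def)
    finally have S: "?S s = (\<Sum>i\<in>I - s. - a i) + (\<Sum>i\<in>s. a i)" .
    have "l * ?S s = (\<Sum>i\<in>s. l * a i) + (\<Sum>i\<in>I - s. - (l * a i))"
      unfolding S by (simp add: sum_distrib_left sum_negf distrib_left right_diff_distrib)
    then show "exp (l * ?S s) = (\<Prod>i\<in>s. exp (l * a i)) * (\<Prod>i\<in>I - s. exp (- (l * a i)))"
      using fs I by (simp add: exp_add exp_sum)
  qed
  also have "\<dots> = (\<Prod>i\<in>I. exp (l * a i) + exp (- (l * a i)))"
    by (rule prod_add[OF I, symmetric])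
  also have "\<dots> \<le> (\<Prod>i\<in>I. 2 * exp ((l * a i)\<^sup>2 / 2))"
    by (intro prod_mono) (auto intro: exp_plus_exp_uminus_le add_nonneg_nonneg)
  also have "\<dots> = 2 ^ card I * exp (\<Sum>i\<in>I. (l * a i)\<^sup>2 / 2)"
    using I by (simp add: prod.distrib exp_sum)
  also have "(\<Sum>i\<in>I. (l * a i)\<^sup>2 / 2) = l\<^sup>2 / 2 * (\<Sum>i\<in>I. (a i)\<^sup>2)"
    by (simp add: sum_distrib_left power_mult_distrib)
  also have "2 ^ card I * exp (l\<^sup>2 / 2 * (\<Sum>i\<in>I. (a i)\<^sup>2)) \<le> 2 ^ card I * exp (l\<^sup>2 / 2 * v)"
    using v by (intro mult_left_mono) (auto intro: mult_left_mono)
  finally have 1: "(\<Sum>s\<in>Pow I. exp (l * ?S s)) \<le> 2 ^ card I * exp (l\<^sup>2 / 2 * v)" .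
  have "real (card ?X) * exp (l * t) = (\<Sum>s\<in>?X. exp (l * t))" by simp
  also have "\<dots> \<le> (\<Sum>s\<in>?X. exp (l * ?S s))"
    using l by (intro sum_mono) (auto intro: mult_left_mono)
  also have "\<dots> \<le> (\<Sum>s\<in>Pow I. exp (l * ?S s))"
    using fin by (intro sum_mono2) auto
  finally have "real (card ?X) * exp (l * t) \<le> 2 ^ card I * exp (l\<^sup>2 / 2 * v)" using 1 by linarith
  then have "real (card ?X) \<le> 2 ^ card I * (exp (l\<^sup>2 / 2 * v) / exp (l * t))"
    by (simp add: field_simps)
  also have "exp (l\<^sup>2 / 2 * v) / exp (l * t) = exp (l\<^sup>2 / 2 * v - l * t)" by (simp add: exp_diff)
  also have "l\<^sup>2 / 2 * v - l * t = - (t\<^sup>2 / (2 * v))"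
    using v by (simp add: l_def power2_eq_square field_simps)
  finally show ?thesis .
qed

lemma rademacher_tail:
  fixes a :: "nat \<Rightarrow> real"
  assumes I: "finite I" and v: "(\<Sum>i\<in>I. (a i)\<^sup>2) \<le> v" "0 < v" and t: "0 \<le> t"
  shows "real (card {s\<in>Pow I. t < \<bar>\<Sum>i\<in>I. rsign s i * a i\<bar>}) \<le> 2 ^ card I * (2 * exp (- (t\<^sup>2 / (2 * v))))"
proof -
  let ?A = "{s\<in>Pow I. t < (\<Sum>i\<in>I. rsign s i * a i)}"
  let ?B = "{s\<in>Pow I. t < (\<Sum>i\<in>I. rsign s i * - a i)}"
  have "card {s\<in>Pow I. t < \<bar>\<Sum>i\<in>I. rsign s i * a i\<bar>} \<le> card (?A \<union> ?B)"
    using I by (intro card_mono) (auto simp: sum_negf abs_if split: if_splits)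
  also have "\<dots> \<le> card ?A + card ?B" by (rule card_Un_le)
  finally have "real (card {s\<in>Pow I. t < \<bar>\<Sum>i\<in>I. rsign s i * a i\<bar>}) \<le> real (card ?A) + real (card ?B)"
    by linarith
  then show ?thesis
    using rademacher_tail_one_sided[OF I v t] rademacher_tail_one_sided[OF I _ v(2) t, of "\<lambda>i. - a i"] v(1)
    by simp
qed

text \<open>
  The set \<open>A\<close> consists of indices of \<open>2n\<close> points; the points \<open>i\<close> and \<open>n + i\<close> form a pair, and changing
  the sign of \<open>i\<close> exchanges the two.
\<close>

definition swap_diff :: "nat \<Rightarrow> nat set \<Rightarrow> nat \<Rightarrow> real" where
  "swap_diff n A i = of_bool (i \<in> A) - of_bool (n + i \<in> A)"

definition swap_sum :: "nat \<Rightarrow> nat set \<Rightarrow> nat set \<Rightarrow> real" where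
  "swap_sum n s A = (\<Sum>i<n. rsign s i * swap_diff n A i)"

lemma sum_lessThan_add: "(\<Sum>i<n + m. f i) = (\<Sum>i<n. f i) + (\<Sum>i<m. f (n + i))"
  for f :: "nat \<Rightarrow> 'a :: comm_monoid_add"
  by (induction m) (auto simp: add.assoc)

text \<open>
  The variance proxy of an increment is controlled by the Hamming distance of the two traces, the
  metric in which the nets of the chaining argument are built.
\<close>

lemma sum_sq_swap_diff_le:
  "(\<Sum>i<n. (swap_diff n A i - swap_diff n B i)\<^sup>2) \<le> 2 * real (card ({..<n + n} \<inter> (A - B \<union> (B - A))))"
proof -
  define \<Delta> where "\<Delta> = A - B \<union> (B - A)"
  have "(\<Sum>i<n. (swap_diff n A i - swap_diff n B i)\<^sup>2)
      \<le> (\<Sum>i<n. 2 * (of_bool (i \<in> \<Delta>) + of_bool (n + i \<in> \<Delta>)))"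
    by (intro sum_mono) (auto simp: swap_diff_def \<Delta>_def)
  also have "\<dots> = 2 * (\<Sum>i<n + n. of_bool (i \<in> \<Delta>))"
    by (simp add: sum_lessThan_add sum.distrib flip: sum_distrib_left)
  also have "(\<Sum>i<n + n. of_bool (i \<in> \<Delta>)) = real (card ({..<n + n} \<inter> \<Delta>))"
    by (simp add: of_bool_def sum.If_cases)
  finally show ?thesis by (simp add: \<Delta>_def)
qed

text \<open>
  \<open>Net k\<close> is a maximal family of members of \<open>T\<close> with pairwise distance above \<open>4\<^sup>-\<^sup>k\<close> times the
  number of points, so its cardinality is bounded by \<open>card_separated_family_le\<close>, and each member of
  \<open>Net (k + 1)\<close> has a parent in \<open>Net k\<close> at distance at most \<open>4\<^sup>-\<^sup>k |J|\<close>. Passing from parent to child costs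
  at most \<open>K (k + 2)/2\<^sup>k\<close>, except for a fraction \<open>\<delta>/2\<^sup>k\<^sup>+\<^sup>2\<close> of the sign vectors. With the cost \<open>K\<close> of the
  root this adds up to less than \<open>7 K\<close>, and the exceptional fractions to less than \<open>\<delta>\<close>. For large \<open>k\<close> the
  net is all of \<open>T\<close>, as distinct members of \<open>T\<close> differ in at least one point.
\<close>

lemma rademacher_chaining:
  fixes \<delta> :: real
  assumes n: "1 \<le> n" and D: "1 \<le> D" and T: "T \<subseteq> Pow {..<n + n}" and vc: "vc_dim_le D T"
    and \<delta>: "0 < \<delta>" "\<delta> < 1"
  defines "K \<equiv> sqrt (8 * real n * (5 * real D + ln (1 / \<delta>)))"
  shows "real (card {s\<in>Pow {..<n}. \<exists>A\<in>T. 7 * K < \<bar>swap_sum n s A\<bar>}) \<le> 2 ^ n * \<delta>"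
proof (cases "T = {}")
  case False
  define J where "J = {..<n + n}"
  define L where "L = ln (1 / \<delta>)"
  define d :: "nat set \<Rightarrow> nat set \<Rightarrow> real" where "d = (\<lambda>A B. card (J \<inter> (A - B \<union> (B - A))))"
  have d_sym: "d A B = d B A" for A B by (simp add: d_def Un_commute)
  have d_le: "d A B \<le> card J" for A B unfolding d_def by (intro of_nat_mono card_mono) (auto simp: J_def)
  have cJ: "card J = 2 * n" by (simp add: J_def)
  have L: "L > 0" using \<delta> by (simp add: L_def)
  have K2: "K\<^sup>2 = 8 * real n * (5 * real D + L)" using L by (simp add: K_def L_def[symmetric])
  have Kpos: "K > 0" using L n D unfolding K_def L_def[symmetric] by (auto intro!: mult_pos_pos add_nonneg_pos)
  have finT: "finite T" using T finite_subset by blast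
  have "\<forall>k. \<exists>T'\<subseteq>T. (\<forall>A\<in>T'. \<forall>B\<in>T'. A \<noteq> B \<longrightarrow> card J / 4 ^ k < d A B) \<and> (\<forall>A\<in>T. \<exists>B\<in>T'. d A B \<le> card J / 4 ^ k)"
    by (intro allI finite_maximal_separated_subset finT d_sym) (simp add: d_def)
  then obtain Net where Net: "\<And>k. Net k \<subseteq> T"
    "\<And>k A B. A \<in> Net k \<Longrightarrow> B \<in> Net k \<Longrightarrow> A \<noteq> B \<Longrightarrow> card J / 4 ^ k < d A B"
    "\<And>k A. A \<in> T \<Longrightarrow> \<exists>B\<in>Net k. d A B \<le> card J / 4 ^ k"
    by metis
  have finNet: "finite (Net k)" for k using Net(1) finT finite_subset by blast
  have neNet: "Net k \<noteq> {}" for k using Net(3) False by blast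
  have lnNet: "ln (card (Net k)) \<le> 4 * D * (k + 1) * ln 2 + 1 / 2" for k
  proof -
    have "ln (card (Net k)) \<le> 2 * real D * ln (4 / (1 / 4 ^ k)) + 1 / 2"
    proof (rule card_separated_family_le[where J = J])
      show "1 / 4 ^ k * real (card J) \<le> real (card (J \<inter> (A - B \<union> (B - A))))"
        if "A \<in> Net k" "B \<in> Net k" "A \<noteq> B" for A B
        using Net(2)[OF that] by (simp add: d_def)
    qed (use n finNet neNet vc_dim_le_subset[OF vc Net(1)] in \<open>auto simp: J_def\<close>)
    also have "4 / (1 / 4 ^ k) = (2::real) ^ (2 * (k + 1))" by (simp add: power_mult)
    also have "ln ((2::real) ^ (2 * (k + 1))) = 2 * (k + 1) * ln 2" by (subst ln_realpow) auto
    finally show ?thesis by (simp add: algebra_simps)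
  qed
  have ln2: "ln 2 \<le> (7/10 :: real)" using ln2_le_25_over_36 by linarith
  \<comment> \<open>The bracket is \<open>1 + (\<Sum>j<k. (j + 2)/2\<^sup>j)\<close>: the root costs 1, the step from \<open>j\<close> to \<open>j + 1\<close> costs \<open>(j + 2)/2\<^sup>j\<close>.\<close>
  define thr where "thr = (\<lambda>k::nat. K * (7 - (2 * k + 6) / 2 ^ k))"
  define bad where "bad = (\<lambda>k. {s\<in>Pow {..<n}. \<exists>A\<in>Net k. thr k < \<bar>swap_sum n s A\<bar>})"
  have fin_bad: "finite (bad k)" for k by (simp add: bad_def)
  have main: "real (card (bad k)) \<le> 2 ^ n * (\<delta> * (1 - 1 / 2 ^ (k + 1)))" for k
  proof (induction k)
    case 0
    obtain A where A: "A \<in> Net 0" using neNet by blast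
    have "B = A" if "B \<in> Net 0" for B
    proof (rule ccontr)
      assume "B \<noteq> A"
      from Net(2)[OF that A this] have "real (card J) < d B A" by simp
      then show False using d_le[of B A] by simp
    qed
    then have Net0: "Net 0 = {A}" using A by blast
    have "real (card (bad 0)) = real (card {s\<in>Pow {..<n}. K < \<bar>\<Sum>i<n. rsign s i * swap_diff n A i\<bar>})"
      by (simp add: bad_def thr_def Net0 swap_sum_def)
    also have "\<dots> \<le> 2 ^ card {..<n} * (2 * exp (- (K\<^sup>2 / (2 * real n))))"
    proof (rule rademacher_tail)
      have "(\<Sum>i<n. (swap_diff n A i)\<^sup>2) \<le> (\<Sum>i<n. 1)"
        by (intro sum_mono) (auto simp: swap_diff_def)
      then show "(\<Sum>i<n. (swap_diff n A i)\<^sup>2) \<le> n" by simp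
    qed (use n Kpos in auto)
    also have "exp (- (K\<^sup>2 / (2 * real n))) \<le> exp (- 2 * ln 2 - L)"
    proof -
      have "K\<^sup>2 / (2 * real n) = 4 * (5 * real D + L)" using n by (simp add: K2 field_simps)
      then have "K\<^sup>2 / (2 * real n) \<ge> 2 * ln 2 + L" using D L ln2 by simp
      then show ?thesis by simp
    qed
    also have "exp (- 2 * ln 2 - L) = \<delta> / 4"
      using \<delta> exp_double[of "ln 2 :: real"] by (simp add: exp_diff exp_minus L_def ln_div field_simps)
    finally show ?case by simp
  next
    case (Suc k)
    have "\<forall>A\<in>Net (Suc k). \<exists>B\<in>Net k. d A B \<le> card J / 4 ^ k" using Net by blast
    then obtain par where par: "\<And>A. A \<in> Net (Suc k) \<Longrightarrow> par A \<in> Net k"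
      "\<And>A. A \<in> Net (Suc k) \<Longrightarrow> d A (par A) \<le> card J / 4 ^ k" by metis
    \<comment> \<open>The increments have variance proxy \<open>4 n/4\<^sup>k\<close>; the factor \<open>k + 2\<close> pays for the cardinality of the net.\<close>
    define t where "t = K * ((k + 2) / 2 ^ k)"
    define new where "new = (\<lambda>A. {s\<in>Pow {..<n}. t < \<bar>\<Sum>i<n. rsign s i * (swap_diff n A i - swap_diff n (par A) i)\<bar>})"
    have fin_new: "finite (new A)" for A by (simp add: new_def)
    have thr_Suc: "thr (Suc k) = thr k + t"
    proof -
      have "real (2 * Suc k + 6) / 2 ^ Suc k = (2 * real (k + 4)) / (2 * 2 ^ k)" by simp
      also have "\<dots> = real (k + 4) / 2 ^ k" by (rule mult_divide_mult_cancel_left) simp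
      also have "real (k + 4) = real (2 * k + 6) - real (k + 2)" by simp
      also have "\<dots> / 2 ^ k = real (2 * k + 6) / 2 ^ k - real (k + 2) / 2 ^ k"
        by (rule diff_divide_distrib)
      finally have eq: "real (2 * Suc k + 6) / 2 ^ Suc k = real (2 * k + 6) / 2 ^ k - real (k + 2) / 2 ^ k" .
      have "K * (7 - (x - y)) = K * (7 - x) + K * y" for x y :: real by (simp add: algebra_simps)
      then show ?thesis unfolding thr_def t_def eq .
    qed
    have "bad (Suc k) \<subseteq> bad k \<union> (\<Union>A\<in>Net (Suc k). new A)"
    proof
      fix s assume "s \<in> bad (Suc k)"
      then obtain A where s: "s \<in> Pow {..<n}" and A: "A \<in> Net (Suc k)"
        and big: "thr (Suc k) < \<bar>swap_sum n s A\<bar>" unfolding bad_def by auto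
      have eq: "(\<Sum>i<n. rsign s i * (swap_diff n A i - swap_diff n (par A) i))
          = swap_sum n s A - swap_sum n s (par A)"
        by (simp add: swap_sum_def algebra_simps sum_subtractf)
      show "s \<in> bad k \<union> (\<Union>A\<in>Net (Suc k). new A)"
      proof (cases "t < \<bar>swap_sum n s A - swap_sum n s (par A)\<bar>")
        case True
        then have "s \<in> new A" using s unfolding new_def by (simp add: eq)
        then show ?thesis using A by blast
      next
        case False
        then have "thr k < \<bar>swap_sum n s (par A)\<bar>" using big unfolding thr_Suc by linarith
        then have "s \<in> bad k" unfolding bad_def using par(1)[OF A] s by blast
        then show ?thesis by simp
      qed
    qed
    then have "card (bad (Suc k)) \<le> card (bad k \<union> (\<Union>A\<in>Net (Suc k). new A))"
      by (intro card_mono) (auto simp: finNet fin_bad fin_new)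
    also have "\<dots> \<le> card (bad k) + (\<Sum>A\<in>Net (Suc k). card (new A))"
      using card_Un_le card_UN_le[OF finNet[of "Suc k"], of new] by (meson add_left_mono order_trans)
    finally have "real (card (bad (Suc k))) \<le> real (card (bad k)) + (\<Sum>A\<in>Net (Suc k). real (card (new A)))"
      by (simp flip: of_nat_sum of_nat_add)
    also have "(\<Sum>A\<in>Net (Suc k). real (card (new A))) \<le> (\<Sum>A\<in>Net (Suc k). 2 ^ n * (2 * exp (- ((5 * real D + L) * (k + 2)\<^sup>2))))"
    proof (rule sum_mono)
      fix A assume A: "A \<in> Net (Suc k)"
      have "real (card (new A)) \<le> 2 ^ card {..<n} * (2 * exp (- (t\<^sup>2 / (2 * (4 * real n / 4 ^ k)))))"
        unfolding new_def
      proof (rule rademacher_tail)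
        have "(\<Sum>i<n. (swap_diff n A i - swap_diff n (par A) i)\<^sup>2) \<le> 2 * d A (par A)"
          using sum_sq_swap_diff_le unfolding d_def J_def by blast
        also have "\<dots> \<le> 4 * real n / 4 ^ k" using par(2)[OF A] by (simp add: cJ)
        finally show "(\<Sum>i<n. (swap_diff n A i - swap_diff n (par A) i)\<^sup>2) \<le> 4 * real n / 4 ^ k" .
        show "0 \<le> t" using Kpos by (simp add: t_def)
      qed (use n in auto)
      also have "t\<^sup>2 / (2 * (4 * real n / 4 ^ k)) = (5 * real D + L) * (k + 2)\<^sup>2"
      proof -
        have "(2 ^ k)\<^sup>2 = (4::real) ^ k" by (simp add: power2_eq_square flip: power_mult_distrib)
        then have "t\<^sup>2 = 8 * real n * (5 * real D + L) * (k + 2)\<^sup>2 / 4 ^ k"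
          by (simp add: t_def power_mult_distrib power_divide K2)
        moreover have "8 * real n * x * y / q / (2 * (4 * real n / q)) = x * y" if "q > 0" for x y q
          using n that by (simp add: field_simps)
        ultimately show ?thesis using n by simp
      qed
      finally show "real (card (new A)) \<le> 2 ^ n * (2 * exp (- ((5 * real D + L) * (k + 2)\<^sup>2)))" by simp
    qed
    also have "\<dots> = 2 ^ n * (real (card (Net (Suc k))) * 2 * exp (- ((5 * real D + L) * (k + 2)\<^sup>2)))" by simp
    also have "real (card (Net (Suc k))) * 2 * exp (- ((5 * real D + L) * (k + 2)\<^sup>2)) \<le> \<delta> / 2 ^ (k + 2)"
    proof -
      have cpos: "real (card (Net (Suc k))) > 0" using finNet neNet by (simp add: card_gt_0_iff)
      have "real (card (Net (Suc k))) * 2 * exp (- ((5 * real D + L) * (k + 2)\<^sup>2))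
          = exp (ln (card (Net (Suc k))) + ln 2 - (5 * real D + L) * (k + 2)\<^sup>2)"
      proof -
        have "c * 2 * exp (- z) = exp (ln c + ln 2 - z)" if "c > 0" for c z :: real
          using that by (simp add: exp_add exp_diff exp_minus divide_inverse)
        from this[OF cpos] show ?thesis .
      qed
      also have "\<dots> \<le> exp (- L - (k + 2) * ln 2)"
      proof -
        define x where "x = real k + 2"
        have x: "x \<ge> 2" by (simp add: x_def)
        have Dr: "real D \<ge> 1" using D by simp
        have Dx: "x \<le> real D * x" using mult_right_mono[of 1 "real D" x] Dr x by simp
        have "ln (card (Net (Suc k))) \<le> 4 * ((real D * x) * ln 2) + 1 / 2"
          using lnNet[of "Suc k"] by (simp add: x_def algebra_simps)
        moreover have "(real D * x) * ln 2 \<le> (real D * x) * (7/10)"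
          using ln2 Dr x by (intro mult_left_mono) auto
        moreover have "x * ln 2 \<le> x * (7/10)" using ln2 x by (intro mult_left_mono) auto
        moreover have "10 * (real D * x) + 2 * (L * x) \<le> (5 * real D + L) * x\<^sup>2"
        proof -
          have "(5 * real D + L) * (2 * x) \<le> (5 * real D + L) * x\<^sup>2"
            using x L by (intro mult_left_mono) (auto simp: power2_eq_square)
          then show ?thesis by (simp add: algebra_simps)
        qed
        moreover have "L \<le> L * x" using x L by simp
        ultimately have "ln (card (Net (Suc k))) + ln 2 - (5 * real D + L) * x\<^sup>2 \<le> - L - x * ln 2"
          using ln2 x Dx L by linarith
        then show ?thesis by (simp add: x_def add.commute)
      qed
      also have "\<dots> = \<delta> / 2 ^ (k + 2)"
      proof -
        have "exp (- L) = \<delta>" using \<delta> by (simp add: L_def ln_div)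
        moreover have "exp (real (k + 2) * ln 2) = (2::real) ^ (k + 2)"
          by (subst exp_of_nat_mult) simp
        ultimately show ?thesis by (simp only: exp_diff)
      qed
      finally show ?thesis .
    qed
    finally have "real (card (bad (Suc k))) \<le> 2 ^ n * (\<delta> * (1 - 1 / 2 ^ (k + 1))) + 2 ^ n * (\<delta> / 2 ^ (k + 2))"
      using Suc.IH by (simp add: mult_left_mono)
    also have "\<dots> = 2 ^ n * (\<delta> * (1 - 1 / 2 ^ (Suc k + 1)))"
    proof -
      define h :: real where "h = 1 / 2 ^ (k + 2)"
      have h: "1 / 2 ^ (k + 1) = 2 * h" "\<delta> / 2 ^ (k + 2) = \<delta> * h" "1 / 2 ^ (Suc k + 1) = h"
        by (simp_all add: h_def)
      show ?thesis unfolding h by (simp add: algebra_simps)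
    qed
    finally show ?case .
  qed
  \<comment> \<open>At a scale below one point the net contains all of \<open>T\<close>.\<close>
  obtain k where k: "real (card J) < 4 ^ k" using real_arch_pow[of 4 "real (card J)"] by auto
  have "T \<subseteq> Net k"
  proof
    fix A assume A: "A \<in> T"
    then obtain B where B: "B \<in> Net k" "d A B \<le> card J / 4 ^ k" using Net(3) by blast
    then have "d A B < 1" using k by (smt (verit) divide_less_eq_1 zero_less_power)
    then have "J \<inter> (A - B \<union> (B - A)) = {}" by (simp add: d_def J_def)
    moreover have "A \<subseteq> J" "B \<subseteq> J" using A B Net(1) T by (auto simp: J_def)
    ultimately have "A = B" by blast
    then show "A \<in> Net k" using B by simp
  qed
  have "thr k \<le> K * 7"
    unfolding thr_def using Kpos by (intro mult_left_mono) auto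
  then have thr_le: "thr k \<le> 7 * K" by simp
  have "{s\<in>Pow {..<n}. \<exists>A\<in>T. 7 * K < \<bar>swap_sum n s A\<bar>} \<subseteq> bad k"
  proof
    fix s assume "s \<in> {s\<in>Pow {..<n}. \<exists>A\<in>T. 7 * K < \<bar>swap_sum n s A\<bar>}"
    then obtain A where "s \<in> Pow {..<n}" "A \<in> Net k" "7 * K < \<bar>swap_sum n s A\<bar>"
      using \<open>T \<subseteq> Net k\<close> by auto
    then show "s \<in> bad k" unfolding bad_def using thr_le by force
  qed
  then have "real (card {s\<in>Pow {..<n}. \<exists>A\<in>T. 7 * K < \<bar>swap_sum n s A\<bar>}) \<le> real (card (bad k))"
    by (intro of_nat_mono card_mono fin_bad)
  also have "\<dots> \<le> 2 ^ n * (\<delta> * (1 - 1 / 2 ^ (k + 1)))" by (rule main)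
  also have "\<dots> \<le> 2 ^ n * \<delta>"
    using \<delta> by (intro mult_left_mono) (auto simp: mult_le_cancel_left1)
  finally show ?thesis .
qed (use \<delta> in simp)

section \<open>Uniform deviation over a VC class\<close>

lemma indep_vars_PiM_components:
  assumes "\<And>i. i \<in> I \<Longrightarrow> prob_space (M i)" "I \<noteq> {}"
  shows "prob_space.indep_vars (Pi\<^sub>M I M) M (\<lambda>i Y. Y i) I"
proof -
  interpret prob_space "Pi\<^sub>M I M" using assms(1) by (rule prob_space_PiM)
  have "distr (Pi\<^sub>M I M) (Pi\<^sub>M I M) (\<lambda>Y. \<lambda>i\<in>I. Y i) = distr (Pi\<^sub>M I M) (Pi\<^sub>M I M) (\<lambda>Y. Y)"
    by (intro distr_cong) (auto simp: space_PiM PiE_restrict)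
  also have "\<dots> = Pi\<^sub>M I M" by simp
  also have "\<dots> = (\<Pi>\<^sub>M i\<in>I. distr (Pi\<^sub>M I M) (M i) (\<lambda>Y. Y i))"
    using assms by (intro PiM_cong refl distr_PiM_component[symmetric]) auto
  finally show ?thesis
    using assms(2) by (subst indep_vars_iff_distr_eq_PiM') auto
qed

lemma empirical_count_concentration:
  fixes N :: "'a measure" and J :: "nat set"
  assumes N: "prob_space N" and J: "finite J" "J \<noteq> {}" and A: "A \<in> sets N" and t: "0 \<le> t"
  shows "measure (Pi\<^sub>M J (\<lambda>_. N)) {Y\<in>space (Pi\<^sub>M J (\<lambda>_. N)). t \<le> \<bar>(\<Sum>i\<in>J. indicator A (Y i)) - card J * measure N A\<bar>}
      \<le> 2 * exp (- 2 * t\<^sup>2 / card J)"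
proof -
  interpret N: prob_space N by fact
  let ?P = "Pi\<^sub>M J (\<lambda>_. N)"
  interpret P: prob_space ?P by (intro prob_space_PiM N)
  have indep: "P.indep_vars (\<lambda>_. borel) (\<lambda>i Y. indicator A (Y i) :: real) J"
    using P.indep_vars_compose2[OF indep_vars_PiM_components[of J "\<lambda>_. N"], of "\<lambda>_. indicator A" "\<lambda>_. borel"] N A J
    by simp
  have E: "P.expectation (\<lambda>Y. indicator A (Y i) :: real) = measure N A" if "i \<in> J" for i
  proof -
    have "P.expectation (\<lambda>Y. indicator A (Y i) :: real) = integral\<^sup>L (distr ?P N (\<lambda>Y. Y i)) (indicator A)"
      using that A by (subst integral_distr) auto
    also have "distr ?P N (\<lambda>Y. Y i) = N"
      using distr_PiM_component[of J "\<lambda>_. N" i] that N by simp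
    finally show ?thesis using A by simp
  qed
  interpret H: indep_interval_bounded_random_variables ?P J "\<lambda>i Y. indicator A (Y i)" "\<lambda>_. 0" "\<lambda>_. 1"
    by unfold_locales (auto simp: J indep)
  interpret H: Hoeffding_ineq ?P J "\<lambda>i Y. indicator A (Y i)" "\<lambda>_. 0" "\<lambda>_. 1" "card J * measure N A"
    by unfold_locales (simp add: E)
  have c: "card J > 0" using J by (simp add: card_gt_0_iff)
  show ?thesis using H.Hoeffding_ineq_abs_ge[OF t] c by simp
qed

lemma measurable_swap_sum [measurable]:
  assumes "A \<in> sets N"
  shows "(\<lambda>Z. swap_sum n s (Z -` A)) \<in> borel_measurable (Pi\<^sub>M {..<n + n} (\<lambda>_. N))"
proof -
  have "(\<lambda>Z. indicator A (Z j) :: real) \<in> borel_measurable (Pi\<^sub>M {..<n + n} (\<lambda>_. N))" if "j < n + n" for j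
    using measurable_compose[OF measurable_component_singleton[of j "{..<n + n}" "\<lambda>_. N"]
      borel_measurable_indicator[OF assms]] that by simp
  then have "(\<lambda>Z. \<Sum>i<n. rsign s i * (indicator A (Z i) - indicator A (Z (n + i)))) \<in> borel_measurable (Pi\<^sub>M {..<n + n} (\<lambda>_. N))"
    by (intro borel_measurable_sum borel_measurable_times borel_measurable_diff) auto
  then show ?thesis
    by (simp add: swap_sum_def swap_diff_def indicator_def of_bool_def)
qed

definition swap_event :: "nat \<Rightarrow> 'a measure \<Rightarrow> 'a set set \<Rightarrow> real \<Rightarrow> nat set \<Rightarrow> (nat \<Rightarrow> 'a) set" where
  "swap_event n N F t s = {Z\<in>space (Pi\<^sub>M {..<n + n} (\<lambda>_. N)). \<exists>A\<in>F. t < \<bar>swap_sum n s (Z -` A)\<bar>}"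

lemma sets_swap_event:
  assumes "countable F" "F \<subseteq> sets N"
  shows "swap_event n N F t s \<in> sets (Pi\<^sub>M {..<n + n} (\<lambda>_. N))"
  unfolding swap_event_def using assms
  by (intro sets.sets_Collect_countable_Ex') (auto intro!: borel_measurable_less borel_measurable_abs measurable_swap_sum)

text \<open>
  Exchanging the points of the pairs outside \<open>s\<close> permutes an i.i.d. sample, which preserves its law and
  puts the corresponding signs in front of the differences.
\<close>

lemma prob_swap_event_eq:
  assumes N: "prob_space N" and F: "countable F" "F \<subseteq> sets N" and s: "s \<subseteq> {..<n}"
  shows "measure (Pi\<^sub>M {..<n + n} (\<lambda>_. N)) (swap_event n N F t s)
       = measure (Pi\<^sub>M {..<n + n} (\<lambda>_. N)) (swap_event n N F t {..<n})"
proof -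
  let ?J = "{..<n + n}"
  let ?P = "Pi\<^sub>M ?J (\<lambda>_. N)"
  \<comment> \<open>The permutation that exchanges \<open>i\<close> and \<open>n + i\<close> for each \<open>i < n\<close> outside \<open>s\<close>.\<close>
  define f where "f j = (if j < n then (if j \<in> s then j else n + j)
    else (if j - n \<in> s then j else j - n))" for j
  let ?T = "\<lambda>Z. \<lambda>j\<in>?J. Z (f j)"
  have f: "inj_on f ?J" "f \<in> ?J \<rightarrow> ?J"
    using s by (auto simp: inj_on_def f_def split: if_splits)
  have T_meas: "?T \<in> measurable ?P ?P"
    using f by (intro measurable_restrict) (auto intro!: measurable_component_singleton)
  have D: "distr ?P ?P ?T = ?P"
    using distr_PiM_reindex[of ?J "\<lambda>_. N" f ?J] f N by simp
  have eq: "swap_sum n {..<n} (?T Z -` A) = swap_sum n s (Z -` A)" for Z :: "nat \<Rightarrow> 'a" and A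
    unfolding swap_sum_def
    by (intro sum.cong) (auto simp: rsign_def swap_diff_def f_def)
  have "measure ?P (swap_event n N F t {..<n}) = measure (distr ?P ?P ?T) (swap_event n N F t {..<n})"
    by (simp only: D)
  also have "\<dots> = measure ?P (?T -` swap_event n N F t {..<n} \<inter> space ?P)"
    by (intro measure_distr T_meas sets_swap_event F)
  also have "?T -` swap_event n N F t {..<n} \<inter> space ?P = swap_event n N F t s"
    using measurable_space[OF T_meas] unfolding swap_event_def vimage_def[of ?T] by (auto simp: eq)
  finally show ?thesis by simp
qed

text \<open>
  By \<open>prob_swap_event_eq\<close> the probability is the average over all sign vectors. Exchanging
  average and expectation leaves, for each fixed sample, the count bounded by chaining.
\<close>

lemma prob_swap_event_le:
  fixes \<delta> :: real
  assumes N: "prob_space N" and F: "countable F" "F \<subseteq> sets N" and vc: "vc_dim_le D F"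
    and nD: "1 \<le> n" "1 \<le> D" and \<delta>: "0 < \<delta>" "\<delta> < 1"
  shows "measure (Pi\<^sub>M {..<n + n} (\<lambda>_. N)) (swap_event n N F (7 * sqrt (8 * real n * (5 * real D + ln (1 / \<delta>)))) {..<n}) \<le> \<delta>"
proof -
  let ?J = "{..<n + n}"
  let ?P = "Pi\<^sub>M ?J (\<lambda>_. N)"
  let ?t = "7 * sqrt (8 * real n * (5 * real D + ln (1 / \<delta>)))"
  let ?B = "swap_event n N F ?t"
  interpret P: prob_space ?P by (intro prob_space_PiM N)
  have meas: "?B s \<in> sets ?P" for s by (intro sets_swap_event F)
  have int: "integrable ?P (indicator (?B s) :: _ \<Rightarrow> real)" for s
    by (rule integrable_real_indicator[OF meas]) (simp add: P.emeasure_eq_measure)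
  have "2 ^ n * measure ?P (?B {..<n}) = (\<Sum>s\<in>Pow {..<n}. measure ?P (?B {..<n}))"
    by (simp add: card_Pow)
  also have "\<dots> = (\<Sum>s\<in>Pow {..<n}. measure ?P (?B s))"
    by (intro sum.cong refl prob_swap_event_eq[OF N F, symmetric]) simp
  also have "\<dots> = (\<Sum>s\<in>Pow {..<n}. P.expectation (indicator (?B s)))"
    using meas by simp
  also have "\<dots> = P.expectation (\<lambda>Z. \<Sum>s\<in>Pow {..<n}. indicator (?B s) Z)"
    by (rule Bochner_Integration.integral_sum[symmetric]) (rule int)
  also have "\<dots> \<le> P.expectation (\<lambda>Z. 2 ^ n * \<delta>)"
  proof (rule integral_mono)
    show "integrable ?P (\<lambda>Z. \<Sum>s\<in>Pow {..<n}. indicator (?B s) Z :: real)"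
      by (intro Bochner_Integration.integrable_sum int)
    fix Z assume Z: "Z \<in> space ?P"
    define T where "T = (\<inter>) ?J ` ((\<lambda>A. Z -` A) ` F)"
    have sw: "swap_sum n s (?J \<inter> A) = swap_sum n s A" for s A
      unfolding swap_sum_def by (intro sum.cong) (auto simp: swap_diff_def)
    have "(\<Sum>s\<in>Pow {..<n}. indicator (?B s) Z :: real) = card {s\<in>Pow {..<n}. Z \<in> ?B s}"
      by (simp add: indicator_def sum.If_cases Int_def)
    also have "{s\<in>Pow {..<n}. Z \<in> ?B s} = {s\<in>Pow {..<n}. \<exists>A\<in>T. ?t < \<bar>swap_sum n s A\<bar>}"
      using Z by (auto simp: swap_event_def T_def sw)
    also have "real (card \<dots>) \<le> 2 ^ n * \<delta>"
    proof (rule rademacher_chaining[OF nD _ _ \<delta>])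
      show "T \<subseteq> Pow ?J" by (auto simp: T_def)
      show "vc_dim_le D T" unfolding T_def by (rule vc_dim_le_traces[OF vc_dim_le_vimage[OF vc]])
    qed
    finally show "(\<Sum>s\<in>Pow {..<n}. indicator (?B s) Z :: real) \<le> 2 ^ n * \<delta>" .
  qed simp
  also have "\<dots> = 2 ^ n * \<delta>" by (simp add: P.prob_space)
  finally show ?thesis by simp
qed

definition deviation_event :: "nat \<Rightarrow> 'a measure \<Rightarrow> 'a set set \<Rightarrow> real \<Rightarrow> (nat \<Rightarrow> 'a) set" where
  "deviation_event n N F t =
     {X\<in>space (Pi\<^sub>M {..<n} (\<lambda>_. N)). \<exists>A\<in>F. t < \<bar>(\<Sum>i<n. indicator A (X i)) - n * measure N A\<bar>}"

lemma sets_deviation_event: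
  assumes "countable F" "F \<subseteq> sets N"
  shows "deviation_event n N F t \<in> sets (Pi\<^sub>M {..<n} (\<lambda>_. N))"
proof -
  have "(\<lambda>X. indicator A (X i) :: real) \<in> borel_measurable (Pi\<^sub>M {..<n} (\<lambda>_. N))" if "A \<in> sets N" "i < n" for A i
    using measurable_compose[OF measurable_component_singleton[of i "{..<n}" "\<lambda>_. N"]
      borel_measurable_indicator[OF that(1)]] that by simp
  then show ?thesis
    unfolding deviation_event_def using assms
    by (intro sets.sets_Collect_countable_Ex')
       (auto intro!: borel_measurable_less borel_measurable_abs borel_measurable_diff borel_measurable_sum)
qed

text \<open>
  Symmetrization. If some set \<open>A\<close> deviates by more than \<open>2 t\<close> on the sample, then on an independent ghost
  sample the same \<open>A\<close> deviates by less than \<open>t\<close> with probability at least 1/2; in that case the two samples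
  differ by more than \<open>t\<close> on \<open>A\<close>. The second hypothesis on \<open>t\<close> makes Hoeffding's bound for the ghost sample
  at most 1/2.
\<close>

lemma prob_deviation_event_le_swap:
  assumes N: "prob_space N" and F: "countable F" "F \<subseteq> sets N" and n: "1 \<le> n"
    and t: "0 \<le> t" "4 * exp (- 2 * t\<^sup>2 / n) \<le> 1"
  shows "measure (Pi\<^sub>M {..<n} (\<lambda>_. N)) (deviation_event n N F (2 * t))
    \<le> 2 * measure (Pi\<^sub>M {..<n + n} (\<lambda>_. N)) (swap_event n N F t {..<n})"
proof -
  let ?I = "{..<n}" and ?J = "{n..<n + n}"
  let ?P = "Pi\<^sub>M ?I (\<lambda>_. N)" and ?Q = "Pi\<^sub>M ?J (\<lambda>_. N)" and ?R = "Pi\<^sub>M {..<n + n} (\<lambda>_. N)"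
  let ?E = "deviation_event n N F (2 * t)" and ?B = "swap_event n N F t {..<n}"
  interpret N: prob_space N by fact
  interpret PS: product_sigma_finite "\<lambda>_. N" by unfold_locales
  interpret P: prob_space ?P by (intro prob_space_PiM N)
  interpret Q: prob_space ?Q by (intro prob_space_PiM N)
  interpret R: prob_space ?R by (intro prob_space_PiM N)
  have IJ: "?I \<union> ?J = {..<n + n}" "?I \<inter> ?J = {}" by auto
  have D: "distr (?P \<Otimes>\<^sub>M ?Q) ?R (merge ?I ?J) = ?R"
    using PS.distr_merge[of ?I ?J] IJ by simp
  have mm: "merge ?I ?J \<in> measurable (?P \<Otimes>\<^sub>M ?Q) ?R"
    using measurable_merge[of ?I ?J "\<lambda>_. N"] IJ by simp
  have B: "?B \<in> sets ?R" by (intro sets_swap_event F)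
  let ?S = "merge ?I ?J -` ?B \<inter> space (?P \<Otimes>\<^sub>M ?Q)"
  have S: "?S \<in> sets (?P \<Otimes>\<^sub>M ?Q)" using measurable_sets[OF mm B] .
  \<comment> \<open>Given a bad sample, at least half of the ghost samples lead to a bad swap.\<close>
  have half: "ennreal (1 / 2) * indicator ?E X \<le> emeasure ?Q (Pair X -` ?S)" if X: "X \<in> space ?P" for X
  proof (cases "X \<in> ?E")
    case True
    then obtain A where A: "A \<in> F" and big: "2 * t < \<bar>(\<Sum>i<n. indicator A (X i)) - n * measure N A\<bar>"
      by (auto simp: deviation_event_def)
    let ?G = "{Y\<in>space ?Q. t \<le> \<bar>(\<Sum>i\<in>?J. indicator A (Y i)) - n * measure N A\<bar>}"
    have "measure ?Q ?G \<le> 2 * exp (- 2 * t\<^sup>2 / n)"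
      using empirical_count_concentration[OF N, of ?J A t] A F n t by auto
    then have G: "measure ?Q ?G \<le> 1 / 2" using t by simp
    have "(\<lambda>Y. indicator A (Y i) :: real) \<in> borel_measurable ?Q" if "i \<in> ?J" for i
      using measurable_compose[OF measurable_component_singleton[of i ?J "\<lambda>_. N"]
        borel_measurable_indicator[of A N]] that A F by auto
    then have Gs: "?G \<in> sets ?Q"
      by (auto intro!: borel_measurable_le borel_measurable_abs borel_measurable_diff borel_measurable_sum)
    have sub: "space ?Q - ?G \<subseteq> Pair X -` ?S"
    proof
      fix Y assume Y: "Y \<in> space ?Q - ?G"
      have XY: "(X, Y) \<in> space (?P \<Otimes>\<^sub>M ?Q)" using X Y by (simp add: space_pair_measure)
      then have m: "merge ?I ?J (X, Y) \<in> space ?R" using measurable_space[OF mm] by blast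
      have "(\<Sum>i\<in>?J. indicator A (Y i)) = (\<Sum>i<n. indicator A (Y (n + i)) :: real)"
        by (rule sum.reindex_bij_witness[of _ "\<lambda>i. n + i" "\<lambda>i. i - n"]) auto
      moreover have "swap_sum n {..<n} (merge ?I ?J (X, Y) -` A)
          = (\<Sum>i<n. indicator A (X i) - indicator A (Y (n + i)))"
        unfolding swap_sum_def
        by (intro sum.cong) (auto simp: rsign_def swap_diff_def merge_def indicator_def)
      ultimately have "swap_sum n {..<n} (merge ?I ?J (X, Y) -` A)
          = (\<Sum>i<n. indicator A (X i)) - (\<Sum>i\<in>?J. indicator A (Y i))"
        by (simp add: sum_subtractf)
      moreover have "\<bar>(\<Sum>i\<in>?J. indicator A (Y i)) - n * measure N A\<bar> < t"
        using Y by auto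
      ultimately have "t < \<bar>swap_sum n {..<n} (merge ?I ?J (X, Y) -` A)\<bar>"
        using big by linarith
      then show "Y \<in> Pair X -` ?S" using A m XY by (auto simp: swap_event_def)
    qed
    have PS: "Pair X -` ?S \<in> sets ?Q" using S by (rule sets_Pair1)
    have "1 / 2 \<le> measure ?Q (space ?Q - ?G)" using Q.prob_compl[OF Gs] G by simp
    also have "\<dots> \<le> measure ?Q (Pair X -` ?S)" by (intro Q.finite_measure_mono sub PS)
    finally have "ennreal (1 / 2) \<le> emeasure ?Q (Pair X -` ?S)"
      unfolding Q.emeasure_eq_measure by (rule ennreal_leI)
    then show ?thesis using True by (simp del: vimage_Int)
  qed simp
  have E: "?E \<in> sets ?P" by (intro sets_deviation_event F)
  have "ennreal (1 / 2) * emeasure ?P ?E = (\<integral>\<^sup>+X. ennreal (1 / 2) * indicator ?E X \<partial>?P)"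
    using E by (simp add: nn_integral_cmult_indicator)
  also have "\<dots> \<le> (\<integral>\<^sup>+X. emeasure ?Q (Pair X -` ?S) \<partial>?P)"
    by (intro nn_integral_mono half)
  also have "\<dots> = emeasure (?P \<Otimes>\<^sub>M ?Q) ?S"
    by (rule Q.emeasure_pair_measure_alt[OF S, symmetric])
  also have "\<dots> = emeasure (distr (?P \<Otimes>\<^sub>M ?Q) ?R (merge ?I ?J)) ?B"
    by (rule emeasure_distr[OF mm B, symmetric])
  also have "\<dots> = emeasure ?R ?B" by (simp only: D)
  finally have "ennreal (1 / 2) * ennreal (measure ?P ?E) \<le> ennreal (measure ?R ?B)"
    unfolding P.emeasure_eq_measure R.emeasure_eq_measure .
  then have "ennreal (1 / 2 * measure ?P ?E) \<le> ennreal (measure ?R ?B)"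
    unfolding ennreal_mult''[OF measure_nonneg] .
  then have "1 / 2 * measure ?P ?E \<le> measure ?R ?B"
    using ennreal_le_iff[OF measure_nonneg] by blast
  then show ?thesis by simp
qed

text \<open>
  The uniform law of large numbers for a VC class at the optimal rate: in terms of frequencies the deviation
  is of order \<open>((D + log (1/\<delta>))/n)\<^sup>1\<^sup>/\<^sup>2\<close>.
\<close>

theorem vc_uniform_deviation:
  fixes \<delta> :: real
  assumes N: "prob_space N" and F: "countable F" "F \<subseteq> sets N" and vc: "vc_dim_le D F"
    and nD: "1 \<le> n" "1 \<le> D" and \<delta>: "0 < \<delta>" "\<delta> < 1"
  shows "measure (Pi\<^sub>M {..<n} (\<lambda>_. N)) (deviation_event n N F (14 * sqrt (8 * real n * (5 * real D + ln (1 / \<delta>))))) \<le> 2 * \<delta>"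
proof -
  define K where "K = sqrt (8 * real n * (5 * real D + ln (1 / \<delta>)))"
  have L: "ln (1 / \<delta>) > 0" using \<delta> by simp
  have K2: "K\<^sup>2 = 8 * real n * (5 * real D + ln (1 / \<delta>))" using L by (simp add: K_def)
  have "real n * 1 \<le> real n * (8 * (5 * real D + ln (1 / \<delta>)))"
    using L nD by (intro mult_left_mono) auto
  then have "K\<^sup>2 \<ge> n" unfolding K2 by (simp add: algebra_simps)
  then have K7: "(7 * K)\<^sup>2 \<ge> n" by (simp add: power_mult_distrib)
  have "- 2 * q / n \<le> - 2" if "n \<le> q" for q :: real
    using that nD by (simp add: field_simps)
  from this[OF K7] have "exp (- 2 * (7 * K)\<^sup>2 / n) \<le> exp (- 2)" by simp
  also have "exp (- 2 :: real) \<le> 1 / 4"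
  proof -
    have "2 * 2 \<le> exp 1 * exp (1 :: real)"
      using exp_ge_add_one_self[of 1] by (intro mult_mono) auto
    then have "4 \<le> exp (2 :: real)" by (simp flip: exp_add)
    then show ?thesis by (simp add: exp_minus field_simps)
  qed
  finally have e: "4 * exp (- 2 * (7 * K)\<^sup>2 / n) \<le> 1" by simp
  have K0: "0 \<le> 7 * K" using L by (simp add: K_def)
  have 1: "measure (Pi\<^sub>M {..<n} (\<lambda>_. N)) (deviation_event n N F (2 * (7 * K)))
    \<le> 2 * measure (Pi\<^sub>M {..<n + n} (\<lambda>_. N)) (swap_event n N F (7 * K) {..<n})"
    by (rule prob_deviation_event_le_swap[OF N F nD(1) K0 e])
  have 2: "measure (Pi\<^sub>M {..<n + n} (\<lambda>_. N)) (swap_event n N F (7 * K) {..<n}) \<le> \<delta>"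
    unfolding K_def by (rule prob_swap_event_le[OF N F vc nD \<delta>])
  have "a \<le> 2 * b \<Longrightarrow> b \<le> \<delta> \<Longrightarrow> a \<le> 2 * \<delta>" for a b :: real by linarith
  note 3 = this[OF 1 2]
  have eq: "14 * sqrt (8 * real n * (5 * real D + ln (1 / \<delta>))) = 2 * (7 * K)"
    by (simp only: K_def mult.assoc[symmetric])
  show ?thesis unfolding eq by (rule 3)
qed

section \<open>Quadratic forms and norms of matrices\<close>

lemma scalar_prod_self_nonneg: "0 \<le> v \<bullet> v" for v :: "real vec"
  unfolding scalar_prod_def by (intro sum_nonneg) auto

lemma vnorm_square: "(vnorm v)\<^sup>2 = v \<bullet> v"
  unfolding vnorm_def using scalar_prod_self_nonneg by simp

lemma vnorm_nonneg: "0 \<le> vnorm v"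
  unfolding vnorm_def using scalar_prod_self_nonneg by simp

lemma vnorm_smult: "vnorm (a \<cdot>\<^sub>v v) = \<bar>a\<bar> * vnorm v"
proof -
  have "(a \<cdot>\<^sub>v v) \<bullet> (a \<cdot>\<^sub>v v) = a\<^sup>2 * (v \<bullet> v)"
    by (simp add: power2_eq_square)
  then show ?thesis unfolding vnorm_def by (simp add: real_sqrt_mult)
qed

lemma scalar_prod_self_pos:
  assumes "v \<in> carrier_vec p" "v \<noteq> 0\<^sub>v p"
  shows "0 < v \<bullet> (v :: real vec)"
proof -
  have "\<exists>i<p. v $ i \<noteq> 0"
  proof (rule ccontr)
    assume "\<not> (\<exists>i<p. v $ i \<noteq> 0)"
    then have "v = 0\<^sub>v p" using assms(1) by (intro eq_vecI) auto
    with assms(2) show False ..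
  qed
  then obtain i where i: "i < p" "v $ i \<noteq> 0" by blast
  have "0 < v $ i * v $ i" using i(2) by (meson not_real_square_gt_zero)
  also have "\<dots> \<le> (\<Sum>j\<in>{0..<dim_vec v}. v $ j * v $ j)"
    using i(1) assms(1) by (intro member_le_sum) auto
  finally show ?thesis unfolding scalar_prod_def .
qed

lemma unit_sphere_iff: "u \<in> unit_sphere p \<longleftrightarrow> u \<in> carrier_vec p \<and> u \<bullet> u = 1"
  unfolding unit_sphere_def vnorm_def by auto

lemma unit_vec_in_unit_sphere: "1 \<le> p \<Longrightarrow> unit_vec p 0 \<in> unit_sphere p"
  by (simp add: unit_sphere_iff)

lemma normalize_in_unit_sphere:
  assumes "v \<in> carrier_vec p" "v \<noteq> 0\<^sub>v p"
  shows "(1 / vnorm v) \<cdot>\<^sub>v v \<in> unit_sphere p"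
proof -
  have "vnorm v > 0" using scalar_prod_self_pos[OF assms] by (simp add: vnorm_def)
  then show ?thesis using assms by (simp add: unit_sphere_def vnorm_smult)
qed

lemma scalar_prod_mult_mat_vec_comm:
  fixes A :: "real mat"
  assumes A: "A \<in> carrier_mat p p" "A = transpose_mat A" and xy: "x \<in> carrier_vec p" "y \<in> carrier_vec p"
  shows "x \<bullet> (A *\<^sub>v y) = y \<bullet> (A *\<^sub>v x)"
proof -
  have "x \<bullet> (A *\<^sub>v y) = (A *\<^sub>v y) \<bullet> x" by (rule comm_scalar_prod[OF xy(1)]) (use A xy in simp)
  also have "\<dots> = (transpose_mat A *\<^sub>v y) \<bullet> x" using A(2) by simp
  also have "\<dots> = y \<bullet> (A *\<^sub>v x)" by (rule transpose_vec_mult_scalar[OF A(1) xy])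
  finally show ?thesis .
qed

text \<open>
  A crude bound by the sum of the entries, from \<open>2 |x\<^sub>i x\<^sub>j| \<le> x\<^sub>i\<^sup>2 + x\<^sub>j\<^sup>2\<close>.
\<close>

lemma quadratic_form_bound:
  fixes A :: "real mat"
  assumes A: "A \<in> carrier_mat p p"
  shows "\<exists>c>0. \<forall>x\<in>carrier_vec p. \<bar>x \<bullet> (A *\<^sub>v x)\<bar> \<le> c * (x \<bullet> x)"
proof (intro exI conjI ballI)
  let ?c = "1 + (\<Sum>i\<in>{0..<p}. \<Sum>j\<in>{0..<p}. \<bar>A $$ (i, j)\<bar>)"
  show "0 < ?c" by (intro add_pos_nonneg sum_nonneg) auto
  fix x :: "real vec" assume x: "x \<in> carrier_vec p"
  have sq: "(x $ i)\<^sup>2 \<le> x \<bullet> x" if "i < p" for i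
    unfolding scalar_prod_def power2_eq_square using that x
    by (intro member_le_sum[of i _ "\<lambda>i. x $ i * x $ i"]) auto
  have "\<bar>x $ i * (A $$ (i, j) * x $ j)\<bar> \<le> \<bar>A $$ (i, j)\<bar> * (x \<bullet> x)" if "i < p" "j < p" for i j
  proof -
    have "0 \<le> (\<bar>x $ i\<bar> - \<bar>x $ j\<bar>)\<^sup>2" by simp
    then have "2 * (\<bar>x $ i\<bar> * \<bar>x $ j\<bar>) \<le> (x $ i)\<^sup>2 + (x $ j)\<^sup>2"
      by (simp add: power2_diff)
    then have "\<bar>x $ i\<bar> * \<bar>x $ j\<bar> \<le> x \<bullet> x" using sq[OF that(1)] sq[OF that(2)] by linarith
    then have "\<bar>A $$ (i, j)\<bar> * (\<bar>x $ i\<bar> * \<bar>x $ j\<bar>) \<le> \<bar>A $$ (i, j)\<bar> * (x \<bullet> x)"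
      by (intro mult_left_mono) auto
    then show ?thesis by (simp add: abs_mult mult.left_commute)
  qed
  then have "(\<Sum>i\<in>{0..<p}. \<Sum>j\<in>{0..<p}. \<bar>x $ i * (A $$ (i, j) * x $ j)\<bar>)
      \<le> (\<Sum>i\<in>{0..<p}. \<Sum>j\<in>{0..<p}. \<bar>A $$ (i, j)\<bar> * (x \<bullet> x))"
    by (intro sum_mono) auto
  moreover have "\<bar>x \<bullet> (A *\<^sub>v x)\<bar> \<le> (\<Sum>i\<in>{0..<p}. \<Sum>j\<in>{0..<p}. \<bar>x $ i * (A $$ (i, j) * x $ j)\<bar>)"
  proof -
    have "x \<bullet> (A *\<^sub>v x) = (\<Sum>i\<in>{0..<p}. \<Sum>j\<in>{0..<p}. x $ i * (A $$ (i, j) * x $ j))"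
      using x A by (simp add: scalar_prod_def sum_distrib_left)
    then show ?thesis
      by (simp only:) (rule order_trans[OF sum_abs], intro sum_mono sum_abs)
  qed
  ultimately show "\<bar>x \<bullet> (A *\<^sub>v x)\<bar> \<le> ?c * (x \<bullet> x)"
    using scalar_prod_self_nonneg[of x] by (simp add: distrib_right flip: sum_distrib_right)
qed

lemma discriminant_le_of_nonneg:
  fixes a b c :: real
  assumes "\<And>t. 0 \<le> a + 2 * t * b + t\<^sup>2 * c" "0 \<le> c"
  shows "b\<^sup>2 \<le> a * c"
proof (cases "c = 0")
  case True
  have "b = 0"
  proof (rule ccontr)
    assume "b \<noteq> 0"
    then show False using assms(1)[of "- (a + 1) / (2 * b)"] True by (simp add: field_simps)
  qed
  then show ?thesis using True by simp
next
  case False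
  have "0 \<le> a + 2 * (- b / c) * b + (- b / c)\<^sup>2 * c" by (rule assms)
  also have "\<dots> = a - b\<^sup>2 / c" using False by (simp add: power2_eq_square field_simps)
  finally have "b\<^sup>2 / c \<le> a" by simp
  then show ?thesis using False assms(2) by (simp add: field_simps)
qed

lemma psd_Cauchy_Schwarz:
  assumes B: "psd p B" and xy: "x \<in> carrier_vec p" "y \<in> carrier_vec p"
  shows "(x \<bullet> (B *\<^sub>v y))\<^sup>2 \<le> (x \<bullet> (B *\<^sub>v x)) * (y \<bullet> (B *\<^sub>v y))"
proof (rule discriminant_le_of_nonneg)
  have Bc: "B \<in> carrier_mat p p" and sym: "B = transpose_mat B"
    and nn: "\<And>v. v \<in> carrier_vec p \<Longrightarrow> 0 \<le> v \<bullet> (B *\<^sub>v v)" using B by (auto simp: psd_def)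
  show "0 \<le> y \<bullet> (B *\<^sub>v y)" using nn xy by simp
  fix t :: real
  have c: "B *\<^sub>v x \<in> carrier_vec p" "B *\<^sub>v y \<in> carrier_vec p" using Bc xy by auto
  have "0 \<le> (x + t \<cdot>\<^sub>v y) \<bullet> (B *\<^sub>v (x + t \<cdot>\<^sub>v y))" using nn xy by simp
  also have "B *\<^sub>v (x + t \<cdot>\<^sub>v y) = B *\<^sub>v x + t \<cdot>\<^sub>v (B *\<^sub>v y)"
    using xy Bc by (simp add: mult_add_distrib_mat_vec[OF Bc] mult_mat_vec[OF Bc])
  also have "(x + t \<cdot>\<^sub>v y) \<bullet> (B *\<^sub>v x + t \<cdot>\<^sub>v (B *\<^sub>v y))
      = x \<bullet> (B *\<^sub>v x) + t * (x \<bullet> (B *\<^sub>v y)) + t * (y \<bullet> (B *\<^sub>v x)) + t\<^sup>2 * (y \<bullet> (B *\<^sub>v y))"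
    using xy c
    by (simp add: add_scalar_prod_distrib[of _ p] scalar_prod_add_distrib[of _ p] power2_eq_square algebra_simps)
  also have "y \<bullet> (B *\<^sub>v x) = x \<bullet> (B *\<^sub>v y)" by (rule scalar_prod_mult_mat_vec_comm[OF Bc sym xy(2,1)])
  finally show "0 \<le> x \<bullet> (B *\<^sub>v x) + 2 * t * (x \<bullet> (B *\<^sub>v y)) + t\<^sup>2 * (y \<bullet> (B *\<^sub>v y))"
    by (simp add: algebra_simps)
qed

text \<open>
  With \<open>w = B u\<close>, Cauchy-Schwarz for the form \<open>B\<close> gives
  \<open>|w|\<^sup>4 = (w\<^sup>T B u)\<^sup>2 \<le> (w\<^sup>T B w)(u\<^sup>T B u) \<le> k |w|\<^sup>2 (u\<^sup>T B u)\<close>, and \<open>|w|\<close> is bounded below because \<open>B\<close> has an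
  inverse. This replaces a compactness argument on the sphere.
\<close>

lemma psd_bounded_below_if_det_nonzero:
  assumes B: "psd p B" and det: "det B \<noteq> 0"
  shows "\<exists>c>0. \<forall>u\<in>unit_sphere p. c \<le> u \<bullet> (B *\<^sub>v u)"
proof -
  have Bc: "B \<in> carrier_mat p p" and sym: "B = transpose_mat B"
    using B by (auto simp: psd_def)
  from det_non_zero_imp_unit[OF Bc det, of "()"] obtain C where C: "C \<in> carrier_mat p p" "C * B = 1\<^sub>m p"
    unfolding Units_def by (auto simp: ring_mat_def)
  have CC: "transpose_mat C * C \<in> carrier_mat p p" using C by simp
  obtain c where c: "c > 0" "\<And>x. x \<in> carrier_vec p \<Longrightarrow> \<bar>x \<bullet> ((transpose_mat C * C) *\<^sub>v x)\<bar> \<le> c * (x \<bullet> x)"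
    using quadratic_form_bound[OF CC] by blast
  obtain k where k: "k > 0" "\<And>x. x \<in> carrier_vec p \<Longrightarrow> \<bar>x \<bullet> (B *\<^sub>v x)\<bar> \<le> k * (x \<bullet> x)"
    using quadratic_form_bound[OF Bc] by blast
  show ?thesis
  proof (intro exI conjI ballI)
    show "0 < 1 / (c * k)" using c k by simp
    fix u assume "u \<in> unit_sphere p"
    then have u: "u \<in> carrier_vec p" "u \<bullet> u = 1" by (auto simp: unit_sphere_iff)
    define w where "w = B *\<^sub>v u"
    have w: "w \<in> carrier_vec p" using Bc u by (simp add: w_def)
    have uw: "u = C *\<^sub>v w"
      using C Bc u unfolding w_def by (metis assoc_mult_mat_vec one_mult_mat_vec)
    have "w \<bullet> ((transpose_mat C * C) *\<^sub>v w) = w \<bullet> (transpose_mat C *\<^sub>v u)"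
      using C w uw by simp
    also have "\<dots> = (transpose_mat (transpose_mat C) *\<^sub>v w) \<bullet> u"
      by (rule transpose_vec_mult_scalar[symmetric]) (use C w u in auto)
    also have "\<dots> = 1" using uw u by simp
    finally have 1: "1 \<le> c * (w \<bullet> w)" using c(2)[OF w] by simp
    have "w \<bullet> w = w \<bullet> (B *\<^sub>v u)" by (simp add: w_def)
    then have "(w \<bullet> w)\<^sup>2 \<le> (w \<bullet> (B *\<^sub>v w)) * (u \<bullet> (B *\<^sub>v u))"
      using psd_Cauchy_Schwarz[OF B w u(1)] by simp
    also have "\<dots> \<le> (k * (w \<bullet> w)) * (u \<bullet> (B *\<^sub>v u))"
      using k(2)[OF w] B u by (intro mult_right_mono) (auto simp: psd_def)
    finally have "(w \<bullet> w) * (w \<bullet> w) \<le> (w \<bullet> w) * (k * (u \<bullet> (B *\<^sub>v u)))"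
      by (simp add: power2_eq_square mult_ac)
    moreover have "w \<bullet> w > 0" using 1 c(1) scalar_prod_self_nonneg[of w]
      by (metis less_eq_real_def mult_zero_right not_one_le_zero)
    ultimately have "w \<bullet> w \<le> k * (u \<bullet> (B *\<^sub>v u))" by simp
    then have "1 \<le> c * (k * (u \<bullet> (B *\<^sub>v u)))" using 1 c(1) by (smt (verit) mult_left_mono)
    then show "1 / (c * k) \<le> u \<bullet> (B *\<^sub>v u)" using c(1) k(1) by (simp add: field_simps)
  qed
qed

lemma finite_singular_values:
  assumes "A \<in> carrier_mat p p"
  shows "finite (singular_values A)"
proof -
  let ?B = "transpose_mat A * A"
  have B: "?B \<in> carrier_mat p p" using assms by simp
  have "char_poly ?B \<noteq> 0" using degree_monic_char_poly[OF B] by auto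
  then have "finite {k. eigenvalue ?B k}"
    unfolding eigenvalue_root_char_poly[OF B] by (rule poly_roots_finite)
  then have "finite (sqrt ` {k. eigenvalue ?B k})" by simp
  moreover have "singular_values A \<subseteq> sqrt ` {k. eigenvalue ?B k}"
  proof
    fix s assume "s \<in> singular_values A"
    then have "s = sqrt (s\<^sup>2)" "eigenvalue ?B (s\<^sup>2)" by (auto simp: singular_values_def)
    then show "s \<in> sqrt ` {k. eigenvalue ?B k}" by blast
  qed
  ultimately show ?thesis by (rule rev_finite_subset)
qed

text \<open>
  Let \<open>R\<close> be the supremum of the quadratic form on the sphere. Then \<open>R I - G\<close> is positive semi-definite and
  its form has infimum 0 on the sphere, so by \<open>psd_bounded_below_if_det_nonzero\<close> it is singular. Hence \<open>R\<close> is an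
  eigenvalue of \<open>G\<close> and \<open>R\<^sup>2\<close> one of \<open>G\<^sup>T G\<close>.
\<close>

lemma quadratic_form_le_s_max:
  assumes G: "psd p G" and u: "u \<in> unit_sphere p"
  shows "u \<bullet> (G *\<^sub>v u) \<le> s_max G"
proof -
  have Gc: "G \<in> carrier_mat p p" and sym: "G = transpose_mat G"
    and nn: "\<And>v. v \<in> carrier_vec p \<Longrightarrow> 0 \<le> v \<bullet> (G *\<^sub>v v)" using G by (auto simp: psd_def)
  define R where "R = (SUP u\<in>unit_sphere p. u \<bullet> (G *\<^sub>v u))"
  obtain c where "c > 0" and c: "\<And>x. x \<in> carrier_vec p \<Longrightarrow> \<bar>x \<bullet> (G *\<^sub>v x)\<bar> \<le> c * (x \<bullet> x)"
    using quadratic_form_bound[OF Gc] by blast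
  have bdd: "bdd_above ((\<lambda>u. u \<bullet> (G *\<^sub>v u)) ` unit_sphere p)"
  proof (rule bdd_aboveI2)
    fix v assume "v \<in> unit_sphere p"
    then show "v \<bullet> (G *\<^sub>v v) \<le> c" using c[of v] by (auto simp: unit_sphere_iff)
  qed
  have leR: "v \<bullet> (G *\<^sub>v v) \<le> R" if "v \<in> unit_sphere p" for v
    unfolding R_def by (rule cSUP_upper[OF that bdd])
  have R0: "0 \<le> R" using leR[OF u] nn[of u] u by (auto simp: unit_sphere_iff)
  define B where "B = R \<cdot>\<^sub>m 1\<^sub>m p - G"
  have Bc: "B \<in> carrier_mat p p" unfolding B_def by (rule minus_carrier_mat[OF Gc])
  have Bv: "B *\<^sub>v v = R \<cdot>\<^sub>v v - G *\<^sub>v v" if "v \<in> carrier_vec p" for v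
  proof -
    have "(R \<cdot>\<^sub>m 1\<^sub>m p) *\<^sub>v v = R \<cdot>\<^sub>v v"
      using that by (intro eq_vecI) auto
    then show ?thesis unfolding B_def using that Gc by (subst minus_mult_distrib_mat_vec) auto
  qed
  have qB: "v \<bullet> (B *\<^sub>v v) = R * (v \<bullet> v) - v \<bullet> (G *\<^sub>v v)" if "v \<in> carrier_vec p" for v
    using that Gc by (simp add: Bv scalar_prod_minus_distrib[of _ p])
  have "psd p B" unfolding psd_def
  proof (intro conjI ballI)
    show "B = transpose_mat B"
    proof (rule eq_matI)
      fix i j assume "i < dim_row (transpose_mat B)" "j < dim_col (transpose_mat B)"
      then have ij: "i < p" "j < p" using Bc by auto
      have "G $$ (i, j) = transpose_mat G $$ (i, j)" using sym by simp
      also have "\<dots> = G $$ (j, i)" using Gc ij by simp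
      finally show "B $$ (i, j) = transpose_mat B $$ (i, j)"
        using ij Gc unfolding B_def by simp
    qed (use Bc in auto)
    fix v :: "real vec" assume v: "v \<in> carrier_vec p"
    show "0 \<le> v \<bullet> (B *\<^sub>v v)"
    proof (cases "v = 0\<^sub>v p")
      case True
      then show ?thesis using Bc by (simp add: scalar_prod_left_zero[of _ p])
    next
      case False
      let ?u = "(1 / vnorm v) \<cdot>\<^sub>v v"
      have pos: "v \<bullet> v > 0" by (rule scalar_prod_self_pos[OF v False])
      have "?u \<bullet> (G *\<^sub>v ?u) \<le> R" by (rule leR[OF normalize_in_unit_sphere[OF v False]])
      also have "?u \<bullet> (G *\<^sub>v ?u) = (1 / vnorm v) * ((1 / vnorm v) * (v \<bullet> (G *\<^sub>v v)))"
        using v Gc by (simp add: mult_mat_vec[OF Gc v])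
      also have "\<dots> = (v \<bullet> (G *\<^sub>v v)) / (vnorm v)\<^sup>2" by (simp add: power2_eq_square)
      also have "\<dots> = (v \<bullet> (G *\<^sub>v v)) / (v \<bullet> v)" by (simp add: vnorm_square)
      finally show ?thesis using pos qB[OF v] by (simp add: field_simps)
    qed
  qed (rule Bc)
  have "det B = 0"
  proof (rule ccontr)
    assume "det B \<noteq> 0"
    then obtain e where e: "e > 0" "\<And>u. u \<in> unit_sphere p \<Longrightarrow> e \<le> u \<bullet> (B *\<^sub>v u)"
      using psd_bounded_below_if_det_nonzero[OF \<open>psd p B\<close>] by blast
    have "R \<le> R - e" unfolding R_def[symmetric]
      unfolding R_def
    proof (rule cSUP_least)
      show "unit_sphere p \<noteq> {}" using u by auto
      fix v assume v: "v \<in> unit_sphere p"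
      then show "v \<bullet> (G *\<^sub>v v) \<le> (SUP u\<in>unit_sphere p. u \<bullet> (G *\<^sub>v u)) - e"
        using e(2)[OF v] qB[of v] unfolding R_def[symmetric] by (auto simp: unit_sphere_iff)
    qed
    with e(1) show False by simp
  qed
  then obtain v where v: "v \<in> carrier_vec p" "v \<noteq> 0\<^sub>v p" "B *\<^sub>v v = 0\<^sub>v p"
    using det_0_iff_vec_prod_zero[OF Bc] by blast
  have Gv: "G *\<^sub>v v = R \<cdot>\<^sub>v v"
  proof (rule eq_vecI)
    fix i assume i: "i < dim_vec (R \<cdot>\<^sub>v v)"
    then have "(R \<cdot>\<^sub>v v - G *\<^sub>v v) $ i = 0" using v Bv[OF v(1)] by simp
    then show "(G *\<^sub>v v) $ i = (R \<cdot>\<^sub>v v) $ i" using i v(1) Gc by simp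
  qed (use v Gc in auto)
  have "(transpose_mat G * G) *\<^sub>v v = G *\<^sub>v (G *\<^sub>v v)"
    using Gc v sym by (metis assoc_mult_mat_vec)
  also have "\<dots> = R\<^sup>2 \<cdot>\<^sub>v v"
    using v(1) by (simp add: Gv mult_mat_vec[OF Gc] smult_smult_assoc power2_eq_square)
  finally have "eigenvalue (transpose_mat G * G) (R\<^sup>2)"
    unfolding eigenvalue_def eigenvector_def using v Gc by (intro exI[of _ v]) auto
  then have "R \<in> singular_values G" using R0 by (simp add: singular_values_def)
  then have "R \<le> s_max G" unfolding s_max_def
    by (intro Max_ge finite_singular_values[OF Gc])
  then show ?thesis using leR[OF u] by simp
qed

text \<open>
  Polarization: for a unit vector \<open>u\<close> with \<open>A u \<noteq> 0\<close> and \<open>v = A u / |A u|\<close>, symmetry gives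
  \<open>4 |A u| = (u + v)\<^sup>T A (u + v) - (u - v)\<^sup>T A (u - v)\<close>, and \<open>|u + v|\<^sup>2 + |u - v|\<^sup>2 = 4\<close>. Non-negativity of
  \<open>op_norm\<close>, a supremum of reals, is stated as well because the bound is squared later.
\<close>

lemma op_norm_symmetric_le:
  assumes A: "A \<in> carrier_mat p p" "A = transpose_mat A" and p: "1 \<le> p"
    and b: "\<And>u. u \<in> unit_sphere p \<Longrightarrow> \<bar>u \<bullet> (A *\<^sub>v u)\<bar> \<le> b"
  shows "0 \<le> op_norm A" "op_norm A \<le> b"
proof -
  have b': "\<bar>x \<bullet> (A *\<^sub>v x)\<bar> \<le> b * (x \<bullet> x)" if x: "x \<in> carrier_vec p" for x
  proof (cases "x = 0\<^sub>v p")
    case True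
    then show ?thesis using A by (simp add: scalar_prod_left_zero[of _ p])
  next
    case False
    let ?u = "(1 / vnorm x) \<cdot>\<^sub>v x"
    have pos: "x \<bullet> x > 0" by (rule scalar_prod_self_pos[OF x False])
    have "\<bar>?u \<bullet> (A *\<^sub>v ?u)\<bar> \<le> b" by (rule b[OF normalize_in_unit_sphere[OF x False]])
    also have "?u \<bullet> (A *\<^sub>v ?u) = (1 / vnorm x) * ((1 / vnorm x) * (x \<bullet> (A *\<^sub>v x)))"
      using x A(1) by (simp add: mult_mat_vec[OF A(1) x])
    also have "\<dots> = (x \<bullet> (A *\<^sub>v x)) / (vnorm x)\<^sup>2" by (simp add: power2_eq_square)
    also have "\<dots> = (x \<bullet> (A *\<^sub>v x)) / (x \<bullet> x)" by (simp add: vnorm_square)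
    finally show ?thesis using pos by (simp add: field_simps)
  qed
  have le: "vnorm (A *\<^sub>v u) \<le> b" if "u \<in> unit_sphere p" for u
  proof (cases "A *\<^sub>v u = 0\<^sub>v p")
    case True
    then show ?thesis using b[OF that] by (simp add: vnorm_def scalar_prod_left_zero[of _ p])
  next
    case False
    have u: "u \<in> carrier_vec p" "u \<bullet> u = 1" using that by (auto simp: unit_sphere_iff)
    define w where "w = A *\<^sub>v u"
    have w: "w \<in> carrier_vec p" "w \<noteq> 0\<^sub>v p" using A u False by (auto simp: w_def)
    define v where "v = (1 / vnorm w) \<cdot>\<^sub>v w"
    have v: "v \<in> carrier_vec p" "v \<bullet> v = 1"
      using normalize_in_unit_sphere[OF w] by (auto simp: v_def unit_sphere_iff)
    have nw: "vnorm w > 0" using scalar_prod_self_pos[OF w] by (simp add: vnorm_def)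
    have "v \<bullet> w = (1 / vnorm w) * (w \<bullet> w)" using w by (simp add: v_def)
    also have "\<dots> = vnorm w" using nw by (simp add: vnorm_square[symmetric] power2_eq_square)
    finally have vw: "v \<bullet> (A *\<^sub>v u) = vnorm w" by (simp add: w_def)
    have c: "A *\<^sub>v u \<in> carrier_vec p" "A *\<^sub>v v \<in> carrier_vec p" using A u v by auto
    have uv: "u \<bullet> (A *\<^sub>v v) = v \<bullet> (A *\<^sub>v u)" by (rule scalar_prod_mult_mat_vec_comm[OF A u(1) v(1)])
    have vu: "v \<bullet> u = u \<bullet> v" by (rule comm_scalar_prod[OF v(1) u(1)])
    have 1: "(u + v) \<bullet> (A *\<^sub>v (u + v)) - (u - v) \<bullet> (A *\<^sub>v (u - v)) = 4 * vnorm w"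
      using u v c vw uv
      by (simp add: mult_add_distrib_mat_vec[OF A(1)] mult_minus_distrib_mat_vec[OF A(1)]
          add_scalar_prod_distrib[of _ p] scalar_prod_add_distrib[of _ p]
          minus_scalar_prod_distrib[of _ p] scalar_prod_minus_distrib[of _ p])
    have 2: "(u + v) \<bullet> (u + v) + (u - v) \<bullet> (u - v) = 4"
      using u v vu
      by (simp add: add_scalar_prod_distrib[of _ p] scalar_prod_add_distrib[of _ p]
          minus_scalar_prod_distrib[of _ p] scalar_prod_minus_distrib[of _ p])
    have "\<bar>(u + v) \<bullet> (A *\<^sub>v (u + v))\<bar> \<le> b * ((u + v) \<bullet> (u + v))"
      "\<bar>(u - v) \<bullet> (A *\<^sub>v (u - v))\<bar> \<le> b * ((u - v) \<bullet> (u - v))"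
      using b' u v by auto
    then have "4 * vnorm w \<le> b * ((u + v) \<bullet> (u + v) + (u - v) \<bullet> (u - v))"
      unfolding 1[symmetric] distrib_left by linarith
    then show ?thesis unfolding 2 w_def by simp
  qed
  have dc: "dim_col A = p" using A by simp
  have ne: "unit_sphere p \<noteq> {}" using unit_vec_in_unit_sphere[OF p] by auto
  show "op_norm A \<le> b" unfolding op_norm_def dc by (rule cSUP_least[OF ne le])
  have "vnorm (A *\<^sub>v unit_vec p 0) \<le> op_norm A" unfolding op_norm_def dc
    by (intro cSUP_upper unit_vec_in_unit_sphere p bdd_aboveI2[OF le])
  then show "0 \<le> op_norm A" using vnorm_nonneg order_trans by blast
qed

section \<open>Half-spaces and slabs\<close>

text \<open>
  One step of Gaussian elimination removes the last coordinate together with one vector, which reduces \<open>d\<close>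
  by 1.
\<close>

lemma linear_dependence:
  fixes y :: "'i \<Rightarrow> nat \<Rightarrow> real"
  assumes "finite I" "d < card I"
  shows "\<exists>l. (\<exists>i\<in>I. l i \<noteq> 0) \<and> (\<forall>k<d. (\<Sum>i\<in>I. l i * y i k) = 0)"
  using assms
proof (induction d arbitrary: I y)
  case 0
  then have "I \<noteq> {}" by auto
  then show ?case by (intro exI[of _ "\<lambda>_. 1"]) auto
next
  case (Suc d)
  show ?case
  proof (cases "\<forall>i\<in>I. y i d = 0")
    case True
    obtain l where l: "\<exists>i\<in>I. l i \<noteq> 0" "\<forall>k<d. (\<Sum>i\<in>I. l i * y i k) = 0"
      using Suc.IH[of I y] Suc.prems by auto
    then show ?thesis using True by (intro exI[of _ l]) (auto simp: less_Suc_eq)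
  next
    case False
    then obtain i0 where i0: "i0 \<in> I" "y i0 d \<noteq> 0" by blast
    define I' where "I' = I - {i0}"
    define z where "z i k = y i k - y i d / y i0 d * y i0 k" for i k
    have "finite I'" "d < card I'" using Suc.prems i0 by (auto simp: I'_def)
    then obtain l where l: "\<exists>i\<in>I'. l i \<noteq> 0" "\<forall>k<d. (\<Sum>i\<in>I'. l i * z i k) = 0"
      using Suc.IH[of I' z] by blast
    \<comment> \<open>The coefficient at the pivot cancels the pivot terms that the elimination introduced.\<close>
    define l' where "l' i = (if i = i0 then - (\<Sum>i\<in>I'. l i * (y i d / y i0 d)) else l i)" for i
    have eq: "(\<Sum>i\<in>I. l' i * y i k) = (\<Sum>i\<in>I'. l i * z i k)" for k
    proof -
      have "(\<Sum>i\<in>I. l' i * y i k) = l' i0 * y i0 k + (\<Sum>i\<in>I'. l' i * y i k)"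
        unfolding I'_def using Suc.prems i0 by (simp add: sum.remove)
      also have "(\<Sum>i\<in>I'. l' i * y i k) = (\<Sum>i\<in>I'. l i * y i k)"
        by (intro sum.cong) (auto simp: l'_def I'_def)
      also have "l' i0 * y i0 k = - (\<Sum>i\<in>I'. l i * (y i d / y i0 d) * y i0 k)"
        by (simp add: l'_def sum_distrib_right)
      finally show ?thesis by (simp add: z_def algebra_simps sum_subtractf)
    qed
    have "(\<Sum>i\<in>I'. l i * z i d) = 0" using i0 by (simp add: z_def)
    then have "\<forall>k<Suc d. (\<Sum>i\<in>I. l' i * y i k) = 0"
      using l(2) unfolding eq by (auto simp: less_Suc_eq)
    moreover have "\<exists>i\<in>I. l' i \<noteq> 0" using l(1) by (auto simp: l'_def I'_def)
    ultimately show ?thesis by blast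
  qed
qed

definition halfspace :: "nat \<Rightarrow> real vec \<Rightarrow> real \<Rightarrow> real vec set" where
  "halfspace p u c = {x\<in>carrier_vec p. u \<bullet> x \<le> c}"

text \<open>
  Among more than \<open>p + 1\<close> points there is an affine dependence, with coefficients \<open>l\<close> of sum 0. Were
  the points shattered, some half-space would contain exactly those with \<open>l \<ge> 0\<close>. Then the
  products \<open>l x * (c - u \<bullet> x)\<close> are non-negative and sum to 0, so no coefficient is negative,
  and all of them vanish.
\<close>

lemma vc_dim_halfspaces: "vc_dim_le (p + 1) {halfspace p u c |u c. u \<in> carrier_vec p}"
  unfolding vc_dim_le_def
proof (intro allI impI, elim conjE, rule ccontr)
  fix S assume S: "finite S" and sh: "shatters {halfspace p u c |u c. u \<in> carrier_vec p} S"
    and "\<not> card S \<le> p + 1"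
  then have card: "p + 1 < card S" by simp
  have "\<exists>A\<in>{halfspace p u c |u c. u \<in> carrier_vec p}. S \<inter> A = S"
    by (rule shattersD[OF sh]) simp
  then have SC: "S \<subseteq> carrier_vec p" by (auto simp: halfspace_def)
  define y where "y x k = (if k < p then x $ k else 1)" for x :: "real vec" and k
  obtain l where l: "\<exists>x\<in>S. l x \<noteq> 0" "\<forall>k<p + 1. (\<Sum>x\<in>S. l x * y x k) = 0"
    using linear_dependence[OF S card, of y] by blast
  have l0: "(\<Sum>x\<in>S. l x) = 0" using l(2)[rule_format, of p] by (simp add: y_def)
  have lk: "(\<Sum>x\<in>S. l x * x $ k) = 0" if "k < p" for k
    using l(2)[rule_format, of k] that by (simp add: y_def)
  define neg where "neg = {x\<in>S. l x < 0}"
  have "\<exists>A\<in>{halfspace p u c |u c. u \<in> carrier_vec p}. S \<inter> A = S - neg"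
    by (rule shattersD[OF sh]) blast
  then obtain u c where u: "u \<in> carrier_vec p" and A: "S \<inter> halfspace p u c = S - neg" by blast
  have side: "u \<bullet> x \<le> c \<longleftrightarrow> 0 \<le> l x" if "x \<in> S" for x
    using A that SC by (auto simp: halfspace_def neg_def set_eq_iff not_less)
  have "(\<Sum>x\<in>S. l x * (u \<bullet> x)) = (\<Sum>x\<in>S. \<Sum>k\<in>{0..<p}. u $ k * (l x * x $ k))"
    using SC by (intro sum.cong refl) (auto simp: scalar_prod_def sum_distrib_left mult_ac)
  also have "\<dots> = (\<Sum>k\<in>{0..<p}. u $ k * (\<Sum>x\<in>S. l x * x $ k))"
    by (subst sum.swap) (simp add: sum_distrib_left)
  also have "\<dots> = 0" using lk by simp
  finally have "(\<Sum>x\<in>S. l x * (c - u \<bullet> x)) = 0"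
    using l0 by (simp add: right_diff_distrib sum_subtractf flip: sum_distrib_right)
  moreover have "0 \<le> l x * (c - u \<bullet> x)" if "x \<in> S" for x
    using side[OF that] by (cases "0 \<le> l x") (auto intro: mult_nonneg_nonneg mult_nonpos_nonpos)
  ultimately have "\<forall>x\<in>S. l x * (c - u \<bullet> x) = 0"
    using S by (subst (asm) sum_nonneg_eq_0_iff) auto
  then have "\<forall>x\<in>S. 0 \<le> l x" using side by fastforce
  then have "\<forall>x\<in>S. l x = 0" using l0 S by (subst (asm) sum_nonneg_eq_0_iff) auto
  with l(1) show False by blast
qed

text \<open>
  Lists are a countable type, and those of length \<open>p\<close> already supply every rational normal vector.
\<close>

definition rational_halfspaces :: "nat \<Rightarrow> real vec set set" where
  "rational_halfspaces p =
     range (\<lambda>(qs :: rat list, r :: rat). halfspace p (vec p (\<lambda>i. of_rat (qs ! i))) (of_rat r))"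

lemma countable_rational_halfspaces: "countable (rational_halfspaces p)"
  unfolding rational_halfspaces_def by (intro countable_image) simp

lemma vc_dim_rational_halfspaces: "vc_dim_le (p + 1) (rational_halfspaces p)"
  by (rule vc_dim_le_subset[OF vc_dim_halfspaces]) (auto simp: rational_halfspaces_def)

lemma space_borel_vec [simp]: "space (borel_vec p) = carrier_vec p"
  unfolding borel_vec_def by simp

lemma measurable_vec_index:
  assumes "i < p"
  shows "(\<lambda>v. v $ i) \<in> borel_measurable (borel_vec p)"
proof -
  have "(\<lambda>v. \<lambda>i\<in>{..<p}. v $ i) \<in> measurable (borel_vec p) (Pi\<^sub>M {..<p} (\<lambda>_. borel :: real measure))"
    unfolding borel_vec_def by (rule measurable_vimage_algebra1) (auto simp: space_PiM)
  from measurable_compose[OF this measurable_component_singleton[of i]] assms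
  show ?thesis by simp
qed

lemma measurable_scalar_prod:
  "(\<lambda>x. u \<bullet> x) \<in> borel_measurable (borel_vec p)"
proof -
  have "(\<lambda>x. \<Sum>i\<in>{0..<p}. u $ i * x $ i) \<in> borel_measurable (borel_vec p)"
    by (intro borel_measurable_sum borel_measurable_times borel_measurable_const measurable_vec_index) simp
  then show ?thesis
    by (rule measurable_cong[THEN iffD1, rotated]) (simp add: scalar_prod_def)
qed

lemma sets_scalar_prod_pred:
  assumes "sets N = sets (borel_vec p)" "{t. P t} \<in> sets (borel :: real measure)"
  shows "{x\<in>carrier_vec p. P (u \<bullet> x)} \<in> sets N"
proof -
  have "(\<lambda>x. u \<bullet> x) -` {t. P t} \<inter> space (borel_vec p) \<in> sets (borel_vec p)"
    by (rule measurable_sets[OF measurable_scalar_prod assms(2)])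
  also have "(\<lambda>x. u \<bullet> x) -` {t. P t} \<inter> space (borel_vec p) = {x\<in>carrier_vec p. P (u \<bullet> x)}" by auto
  finally show ?thesis using assms(1) by simp
qed

lemma sets_halfspace:
  assumes "sets N = sets (borel_vec p)"
  shows "halfspace p u c \<in> sets N"
  unfolding halfspace_def using assms by (rule sets_scalar_prod_pred) (simp flip: atMost_def)

text \<open>
  The deviation is kept in counts instead of frequencies, as in \<open>deviation_event\<close>, so that
  no division by \<open>n\<close> enters the limit arguments.
\<close>

definition count_dev :: "nat \<Rightarrow> 'a measure \<Rightarrow> (nat \<Rightarrow> 'a) \<Rightarrow> 'a set \<Rightarrow> real" where
  "count_dev n N X A = \<bar>(\<Sum>i<n. indicator A (X i)) - n * measure N A\<bar>"

lemma count_dev_pointwise_limit: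
  assumes N: "prob_space N" and A: "\<And>k. A k \<in> sets N" "B \<in> sets N"
    and lim: "\<And>x. x \<in> space N \<Longrightarrow> eventually (\<lambda>k. x \<in> A k \<longleftrightarrow> x \<in> B) sequentially"
    and X: "\<And>i. i < n \<Longrightarrow> X i \<in> space N" and le: "\<And>k. count_dev n N X (A k) \<le> t"
  shows "count_dev n N X B \<le> t"
proof -
  interpret prob_space N by fact
  have "(\<lambda>k. \<integral>x. indicator (A k) x \<partial>N) \<longlonglongrightarrow> (\<integral>x. indicator B x \<partial>N :: real)"
  proof (rule integral_dominated_convergence[where w = "\<lambda>_. 1"])
    show "AE x in N. (\<lambda>k. indicator (A k) x) \<longlonglongrightarrow> (indicator B x :: real)"
    proof (rule AE_I2)
      fix x assume "x \<in> space N"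
      from lim[OF this] have "eventually (\<lambda>k. indicator (A k) x = (indicator B x :: real)) sequentially"
        by eventually_elim (simp add: indicator_def)
      then show "(\<lambda>k. indicator (A k) x) \<longlonglongrightarrow> (indicator B x :: real)" by (rule tendsto_eventually)
    qed
    show "indicator B \<in> borel_measurable N" "\<And>k. indicator (A k) \<in> borel_measurable N"
      by (intro borel_measurable_indicator A)+
    show "integrable N (\<lambda>_. 1 :: real)" by simp
    show "AE x in N. norm (indicator (A k) x :: real) \<le> 1" for k
      by (rule AE_I2) (simp add: indicator_def)
  qed
  then have P: "(\<lambda>k. measure N (A k)) \<longlonglongrightarrow> measure N B" using A by simp
  have "eventually (\<lambda>k. \<forall>i\<in>{..<n}. X i \<in> A k \<longleftrightarrow> X i \<in> B) sequentially"
    by (intro eventually_ball_finite) (auto intro: lim X)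
  then have "eventually (\<lambda>k. (\<Sum>i<n. indicator (A k) (X i)) = (\<Sum>i<n. indicator B (X i) :: real)) sequentially"
    by eventually_elim (auto simp: indicator_def intro!: sum.cong)
  then have E: "(\<lambda>k. \<Sum>i<n. indicator (A k) (X i) :: real) \<longlonglongrightarrow> (\<Sum>i<n. indicator B (X i))"
    by (rule tendsto_eventually)
  have "(\<lambda>k. count_dev n N X (A k)) \<longlonglongrightarrow> count_dev n N X B"
    unfolding count_dev_def by (intro tendsto_intros E P)
  then show ?thesis by (rule LIMSEQ_le_const2) (use le in auto)
qed

text \<open>
  Approximate \<open>u\<close> by rational vectors with error \<open>h\<^sub>k\<^sup>2\<close> and \<open>c\<close> from above by rationals in
  \<open>(c + h\<^sub>k, c + 2 h\<^sub>k)\<close>, where \<open>h\<^sub>k \<rightarrow> 0\<close>. The error of \<open>u\<close> is of smaller order than the margin in \<open>c\<close>, so the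
  half-spaces converge pointwise, also at points of the bounding hyperplane.
\<close>

lemma count_dev_halfspace_le:
  assumes N: "prob_space N" and sets: "sets N = sets (borel_vec p)"
    and X: "\<And>i. i < n \<Longrightarrow> X i \<in> carrier_vec p"
    and rat: "\<And>A. A \<in> rational_halfspaces p \<Longrightarrow> count_dev n N X A \<le> t"
    and u: "u \<in> carrier_vec p"
  shows "count_dev n N X (halfspace p u c) \<le> t"
proof -
  define h where "h k = 1 / real (k + 1)" for k
  have h: "h k > 0" for k by (simp add: h_def)
  have h0: "h \<longlonglongrightarrow> 0" unfolding h_def using LIMSEQ_inverse_real_of_nat by (simp add: inverse_eq_divide add.commute)
  \<comment> \<open>Error \<open>h\<^sub>k\<^sup>2\<close> in the normal vector against a margin of at least \<open>h\<^sub>k\<close> in the offset.\<close>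
  have "\<forall>k i. \<exists>q. \<bar>of_rat q - u $ i\<bar> < (h k)\<^sup>2"
  proof (intro allI)
    fix k i
    have "u $ i < u $ i + (h k)\<^sup>2" using h[of k] by simp
    then obtain q where "u $ i < of_rat q" "of_rat q < u $ i + (h k)\<^sup>2"
      using of_rat_dense by blast
    then have "\<bar>of_rat q - u $ i\<bar> < (h k)\<^sup>2" by linarith
    then show "\<exists>q. \<bar>of_rat q - u $ i\<bar> < (h k)\<^sup>2" by blast
  qed
  then obtain q :: "nat \<Rightarrow> nat \<Rightarrow> rat" where q: "\<And>k i. \<bar>of_rat (q k i) - u $ i\<bar> < (h k)\<^sup>2" by metis
  have "\<exists>r. c + h k < of_rat r \<and> of_rat r < c + 2 * h k" for k
    using of_rat_dense[of "c + h k" "c + 2 * h k"] h[of k] by auto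
  then obtain r :: "nat \<Rightarrow> rat" where r: "\<And>k. c + h k < of_rat (r k)" "\<And>k. of_rat (r k) < c + 2 * h k" by metis
  define U :: "nat \<Rightarrow> real vec" where "U k = vec p (\<lambda>i. of_rat (map (q k) [0..<p] ! i))" for k
  have U: "U k $ i = of_rat (q k i)" if "i < p" for k i using that by (simp add: U_def)
  have mem: "halfspace p (U k) (of_rat (r k)) \<in> rational_halfspaces p" for k
    unfolding rational_halfspaces_def U_def by (intro range_eqI[of _ _ "(map (q k) [0..<p], r k)"]) simp
  have spN: "space N = carrier_vec p" using sets_eq_imp_space_eq[OF sets] by simp
  show ?thesis
  proof (rule count_dev_pointwise_limit[OF N, where A = "\<lambda>k. halfspace p (U k) (of_rat (r k))"])
    fix x assume "x \<in> space N"
    then have x: "x \<in> carrier_vec p" by (simp add: spN)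
    define K where "K = (\<Sum>i\<in>{0..<p}. \<bar>x $ i\<bar>)"
    have K0: "K \<ge> 0" by (simp add: K_def sum_nonneg)
    have dist: "\<bar>U k \<bullet> x - u \<bullet> x\<bar> \<le> (h k * K) * h k" for k
    proof -
      have "U k \<bullet> x - u \<bullet> x = (\<Sum>i\<in>{0..<p}. (U k $ i - u $ i) * x $ i)"
        using x by (simp add: scalar_prod_def sum_subtractf left_diff_distrib)
      also have "\<bar>\<dots>\<bar> \<le> (\<Sum>i\<in>{0..<p}. \<bar>(U k $ i - u $ i) * x $ i\<bar>)" by (rule sum_abs)
      also have "\<dots> \<le> (\<Sum>i\<in>{0..<p}. (h k)\<^sup>2 * \<bar>x $ i\<bar>)"
      proof (rule sum_mono)
        fix i assume "i \<in> {0..<p}"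
        then have "\<bar>U k $ i - u $ i\<bar> \<le> (h k)\<^sup>2" using q[of k i] U[of i k] by simp
        then show "\<bar>(U k $ i - u $ i) * x $ i\<bar> \<le> (h k)\<^sup>2 * \<bar>x $ i\<bar>"
          unfolding abs_mult by (rule mult_right_mono) simp
      qed
      finally show ?thesis by (simp add: K_def sum_distrib_left[symmetric] power2_eq_square mult_ac)
    qed
    have "(\<lambda>k. h k * K) \<longlonglongrightarrow> 0 * K" by (intro tendsto_intros h0)
    then have "eventually (\<lambda>k. h k * K < 1) sequentially" by (rule order_tendstoD) simp
    then have close: "eventually (\<lambda>k. \<bar>U k \<bullet> x - u \<bullet> x\<bar> \<le> h k) sequentially"
    proof eventually_elim
      case (elim k)
      have "(h k * K) * h k \<le> 1 * h k" using elim h[of k] by (intro mult_right_mono) auto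
      then show ?case using dist[of k] by simp
    qed
    show "eventually (\<lambda>k. x \<in> halfspace p (U k) (of_rat (r k)) \<longleftrightarrow> x \<in> halfspace p u c) sequentially"
    proof (cases "u \<bullet> x \<le> c")
      case True
      from close show ?thesis
      proof eventually_elim
        case (elim k)
        then have "U k \<bullet> x \<le> of_rat (r k)" using r(1)[of k] True by linarith
        then show ?case using x True by (simp add: halfspace_def)
      qed
    next
      case False
      then have "eventually (\<lambda>k. h k < (u \<bullet> x - c) / 3) sequentially"
        by (intro order_tendstoD(2)[OF h0]) simp
      with close show ?thesis
      proof eventually_elim
        case (elim k)
        then have "3 * h k < u \<bullet> x - c" "u \<bullet> x - h k \<le> U k \<bullet> x" by auto
        then have "of_rat (r k) < U k \<bullet> x" using r(2)[of k] h[of k] by linarith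
        then show ?case using x False by (simp add: halfspace_def)
      qed
    qed
  qed (use sets X rat mem in \<open>auto intro: sets_halfspace simp: spN\<close>)
qed

text \<open>
  Both kinds of sets have an indicator \<open>1\<^sub>H + 1\<^sub>H\<^sub>' - e\<close> with closed half-spaces \<open>H, H'\<close> of normals \<open>u\<close>
  and \<open>-u\<close> and a constant \<open>e\<close>: for the slab \<open>e = 1\<close>, for the exterior \<open>e = 0\<close>. The exterior with \<open>q = 0\<close> is
  the whole space, where the two half-spaces overlap.
\<close>

lemma count_dev_slab_le:
  assumes N: "prob_space N" and sets: "sets N = sets (borel_vec p)"
    and X: "\<And>i. i < n \<Longrightarrow> X i \<in> carrier_vec p"
    and half: "\<And>u c. u \<in> carrier_vec p \<Longrightarrow> count_dev n N X (halfspace p u c) \<le> t"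
    and u: "u \<in> carrier_vec p" and q: "0 \<le> q"
  shows "count_dev n N X {x\<in>carrier_vec p. (u \<bullet> x)\<^sup>2 \<le> q} \<le> 2 * t"
    and "count_dev n N X {x\<in>carrier_vec p. q \<le> (u \<bullet> x)\<^sup>2} \<le> 2 * t"
proof -
  interpret prob_space N by fact
  have spN: "space N = carrier_vec p" using sets_eq_imp_space_eq[OF sets] by simp
  have mu: "- u \<in> carrier_vec p" using u by simp
  have neg: "(- u) \<bullet> x = - (u \<bullet> x)" if "x \<in> carrier_vec p" for x
    using u that by simp
  have Hs: "halfspace p v c \<in> sets N" for v c by (rule sets_halfspace[OF sets])
  have t0: "0 \<le> t" using half[OF u, of 0] by (simp add: count_dev_def)
  have comb: "count_dev n N X A \<le> 2 * t"
    if A: "A \<in> sets N" and eq: "\<And>x. x \<in> carrier_vec p \<Longrightarrow> (indicator A x :: real) = indicator (halfspace p u c) x + indicator (halfspace p (- u) c) x - e"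
    for A c e
  proof -
    let ?H = "halfspace p u c" and ?H' = "halfspace p (- u) c"
    have "measure N A = (\<integral>x. indicator A x \<partial>N)" using A by simp
    also have "\<dots> = (\<integral>x. indicator ?H x + indicator ?H' x - e \<partial>N)"
      using eq by (intro Bochner_Integration.integral_cong) (auto simp: spN)
    also have "\<dots> = measure N ?H + measure N ?H' - e"
    proof -
      have "integrable N (indicator (halfspace p v c) :: _ \<Rightarrow> real)" for v
        by (rule integrable_real_indicator[OF Hs]) (simp add: emeasure_eq_measure)
      then show ?thesis using Hs by (simp add: prob_space)
    qed
    finally have m: "measure N A = measure N ?H + measure N ?H' - e" .
    have "(\<Sum>i<n. indicator A (X i)) = (\<Sum>i<n. indicator ?H (X i) + indicator ?H' (X i) - e)"
      using X by (intro sum.cong eq) auto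
    also have "\<dots> = (\<Sum>i<n. indicator ?H (X i)) + (\<Sum>i<n. indicator ?H' (X i)) - n * e"
      by (simp add: sum.distrib sum_subtractf)
    finally have s: "(\<Sum>i<n. indicator A (X i)) = \<dots>" .
    have "count_dev n N X A \<le> count_dev n N X ?H + count_dev n N X ?H'"
      unfolding count_dev_def s m by (simp add: algebra_simps)
    also have "\<dots> \<le> 2 * t" using half[OF u, of c] half[OF mu, of c] by simp
    finally show ?thesis .
  qed
  have sq1: "{s :: real. s\<^sup>2 \<le> q} \<in> sets borel" "{s :: real. q \<le> s\<^sup>2} \<in> sets borel" by measurable
  have le: "s\<^sup>2 \<le> q \<longleftrightarrow> s \<le> sqrt q \<and> - s \<le> sqrt q" for s
    using q by (metis abs_le_iff real_sqrt_abs real_sqrt_le_iff)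
  show "count_dev n N X {x\<in>carrier_vec p. (u \<bullet> x)\<^sup>2 \<le> q} \<le> 2 * t"
  proof (rule comb)
    show "{x\<in>carrier_vec p. (u \<bullet> x)\<^sup>2 \<le> q} \<in> sets N"
      by (rule sets_scalar_prod_pred[OF sets sq1(1)])
    fix x :: "real vec" assume x: "x \<in> carrier_vec p"
    have "s \<le> sqrt q \<or> - s \<le> sqrt q" for s
      using real_sqrt_ge_zero[OF q] by linarith
    from this[of "u \<bullet> x"] show "(indicator {x\<in>carrier_vec p. (u \<bullet> x)\<^sup>2 \<le> q} x :: real)
        = indicator (halfspace p u (sqrt q)) x + indicator (halfspace p (- u) (sqrt q)) x - 1"
      using x neg[OF x] le[of "u \<bullet> x"] by (auto simp: indicator_def halfspace_def)
  qed
  show "count_dev n N X {x\<in>carrier_vec p. q \<le> (u \<bullet> x)\<^sup>2} \<le> 2 * t"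
  proof (cases "q = 0")
    case True
    then have eq: "{x\<in>carrier_vec p. q \<le> (u \<bullet> x)\<^sup>2} = space N" by (auto simp: spN)
    have "(\<Sum>i<n. indicator (space N) (X i)) = (\<Sum>i<n. 1 :: real)"
      using X by (intro sum.cong) (auto simp: spN)
    then show ?thesis unfolding eq count_dev_def using t0 by (simp add: prob_space)
  next
    case False
    show ?thesis
    proof (rule comb)
      show "{x\<in>carrier_vec p. q \<le> (u \<bullet> x)\<^sup>2} \<in> sets N"
        by (rule sets_scalar_prod_pred[OF sets sq1(2)])
      fix x :: "real vec" assume x: "x \<in> carrier_vec p"
      have "0 < sqrt q" using q False by simp
      then have "\<not> (s \<le> - sqrt q \<and> - s \<le> - sqrt q)" for s by linarith
      from this[of "u \<bullet> x"] have "\<not> (u \<bullet> x \<le> - sqrt q \<and> - (u \<bullet> x) \<le> - sqrt q)" .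
      moreover have "q \<le> s\<^sup>2 \<longleftrightarrow> s \<le> - sqrt q \<or> - s \<le> - sqrt q" for s
      proof -
        have "q \<le> s\<^sup>2 \<longleftrightarrow> sqrt q \<le> \<bar>s\<bar>" using q by (metis real_sqrt_abs real_sqrt_le_iff)
        then show ?thesis by linarith
      qed
      ultimately show "(indicator {x\<in>carrier_vec p. q \<le> (u \<bullet> x)\<^sup>2} x :: real)
        = indicator (halfspace p u (- sqrt q)) x + indicator (halfspace p (- u) (- sqrt q)) x - 0"
        using x neg[OF x] by (auto simp: indicator_def halfspace_def)
    qed
  qed
qed

section \<open>Elliptical and contaminated laws\<close>

lemma measurable_into_borel_vec:
  assumes "\<And>x. x \<in> space M \<Longrightarrow> g x \<in> carrier_vec p"
    and "\<And>i. i < p \<Longrightarrow> (\<lambda>x. g x $ i) \<in> borel_measurable M"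
  shows "g \<in> measurable M (borel_vec p)"
  unfolding borel_vec_def
proof (rule measurable_vimage_algebra2)
  show "g \<in> space M \<rightarrow> carrier_vec p" using assms(1) by auto
  show "(\<lambda>x. \<lambda>i\<in>{..<p}. g x $ i) \<in> measurable M (Pi\<^sub>M {..<p} (\<lambda>_. borel))"
    by (rule measurable_restrict) (use assms(2) in auto)
qed

lemma vnorm_vec: "(vnorm (vec r z))\<^sup>2 = (\<Sum>i<r. (z i)\<^sup>2)"
  unfolding vnorm_square by (simp add: scalar_prod_def power2_eq_square atLeast0LessThan)

lemma measurable_vnorm_vec:
  "(\<lambda>z. vnorm (vec r z)) \<in> borel_measurable (Pi\<^sub>M {..<r} (\<lambda>_. lborel :: real measure))"
proof -
  have c: "(\<lambda>z. z i) \<in> borel_measurable (Pi\<^sub>M {..<r} (\<lambda>_. lborel :: real measure))" if "i < r" for i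
    using measurable_component_singleton[of i "{..<r}" "\<lambda>_. lborel :: real measure"] that by simp
  have "vnorm (vec r z) = sqrt (\<Sum>i<r. (z i)\<^sup>2)" for z
    using vnorm_vec[of r z] vnorm_nonneg[of "vec r z"] by (simp add: real_sqrt_unique)
  then show ?thesis using c by (auto intro!: borel_measurable_sqrt borel_measurable_sum borel_measurable_power)
qed

text \<open>
  The punctured ball has positive measure, because it contains a small cube away from the origin, and finite
  measure, because it lies in the cube of side 2. So the normalisation of Lebesgue measure makes sense.
\<close>

lemma prob_space_uniform_sphere:
  assumes r: "1 \<le> r"
  shows "prob_space (uniform_sphere r)"
proof -
  let ?P = "Pi\<^sub>M {..<r} (\<lambda>_. lborel :: real measure)"
  let ?S = "{z \<in> space ?P. 0 < vnorm (vec r z) \<and> vnorm (vec r z) \<le> 1}"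
  interpret L: product_sigma_finite "\<lambda>_. lborel :: real measure" by unfold_locales
  have S: "?S \<in> sets ?P"
    using measurable_vnorm_vec by (intro sets.sets_Collect_conj borel_measurable_less borel_measurable_le) auto
  have box: "emeasure ?P (PiE {..<r} (\<lambda>_. {a..b})) = ennreal (b - a) ^ r" if "a \<le> b" for a b
    using that by (subst L.emeasure_PiM) auto
  have nz: "emeasure ?P ?S \<noteq> 0"
  proof
    assume 0: "emeasure ?P ?S = 0"
    \<comment> \<open>The bounds keep the cube away from the origin and inside the ball, as \<open>r (1/r)\<^sup>2 \<le> 1\<close>.\<close>
    let ?B = "PiE {..<r} (\<lambda>_. {1 / (2 * real r)..1 / real r})"
    have "?B \<subseteq> ?S"
    proof
      fix z assume z: "z \<in> ?B"
      then have zi: "1 / (2 * real r) \<le> z i" "z i \<le> 1 / real r" if "i < r" for i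
        using that by (auto simp: PiE_iff)
      have pos: "0 < z i" if "i < r" for i
      proof -
        have "0 < 1 / (2 * real r)" using r by simp
        then show ?thesis using zi(1)[OF that] by linarith
      qed
      have "(\<Sum>i<r. (z i)\<^sup>2) > 0"
      proof (rule sum_pos)
        show "{..<r} \<noteq> {}" using r by (simp add: lessThan_empty_iff)
        show "0 < (z i)\<^sup>2" if "i \<in> {..<r}" for i using pos that by (intro zero_less_power) simp
      qed simp
      then have 1: "0 < vnorm (vec r z)"
        using vnorm_vec[of r z] vnorm_nonneg[of "vec r z"] by (metis less_eq_real_def less_irrefl power_zero_numeral)
      have "(\<Sum>i<r. (z i)\<^sup>2) \<le> (\<Sum>i<r. 1 / real r)"
      proof (rule sum_mono)
        fix i assume "i \<in> {..<r}"
        then have i: "i < r" by simp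
        have "1 / real r \<le> 1" using r by simp
        then have "z i \<le> 1" using zi(2)[OF i] by linarith
        then have "(z i)\<^sup>2 \<le> z i" using pos[OF i] by (simp add: power2_eq_square mult_left_le)
        then show "(z i)\<^sup>2 \<le> 1 / real r" using zi(2)[OF i] by linarith
      qed
      also have "\<dots> = 1" using r by simp
      finally have "(vnorm (vec r z))\<^sup>2 \<le> 1\<^sup>2" by (simp add: vnorm_vec)
      then have "vnorm (vec r z) \<le> 1" by (rule power2_le_imp_le) simp
      with 1 z show "z \<in> ?S" by (auto simp: space_PiM)
    qed
    then have "emeasure ?P ?B \<le> emeasure ?P ?S" by (rule emeasure_mono[OF _ S])
    then have B0: "emeasure ?P ?B = 0" unfolding 0 le_zero_eq .
    have "emeasure ?P ?B = ennreal (1 / real r - 1 / (2 * real r)) ^ r"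
      using r by (intro box) (simp add: field_simps)
    moreover have "ennreal (1 / real r - 1 / (2 * real r)) ^ r \<noteq> 0"
      using r by (simp add: field_simps)
    ultimately show False using B0 by metis
  qed
  have "?S \<subseteq> PiE {..<r} (\<lambda>_. {-1..1})"
  proof
    fix z assume z: "z \<in> ?S"
    have "\<bar>z i\<bar> \<le> 1" if i: "i < r" for i
    proof -
      have "(z i)\<^sup>2 \<le> (\<Sum>i<r. (z i)\<^sup>2)" using i by (intro member_le_sum) auto
      also have "\<dots> = (vnorm (vec r z))\<^sup>2" by (simp add: vnorm_vec)
      also have "\<dots> \<le> 1" using z vnorm_nonneg[of "vec r z"] by (intro power_le_one) auto
      finally show ?thesis by (simp add: abs_square_le_1)
    qed
    then show "z \<in> PiE {..<r} (\<lambda>_. {-1..1})" using z by (auto simp: space_PiM PiE_iff abs_le_iff)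
  qed
  moreover have "PiE {..<r} (\<lambda>_. {-1..1}) \<in> sets ?P"
    by (rule sets_PiM_I_finite) auto
  ultimately have "emeasure ?P ?S \<le> emeasure ?P (PiE {..<r} (\<lambda>_. {-1..1}))"
    by (rule emeasure_mono)
  also have "\<dots> < \<infinity>" by (subst box) (auto simp: power_less_top_ennreal)
  finally have fin: "emeasure ?P ?S \<noteq> \<infinity>" by simp
  interpret U: prob_space "uniform_measure ?P ?S" by (rule prob_space_uniform_measure[OF nz fin])
  have "(\<lambda>z. (1 / vnorm (vec r z)) \<cdot>\<^sub>v vec r z) \<in> measurable (uniform_measure ?P ?S) (borel_vec r)"
  proof (rule measurable_into_borel_vec)
    fix i assume i: "i < r"
    have "(\<lambda>z. z i) \<in> borel_measurable ?P"
      using measurable_component_singleton[of i "{..<r}" "\<lambda>_. lborel :: real measure"] i by simp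
    then have "(\<lambda>z. 1 / vnorm (vec r z) * z i) \<in> borel_measurable ?P"
      using measurable_vnorm_vec[of r] by (intro borel_measurable_times borel_measurable_divide) auto
    then show "(\<lambda>z. ((1 / vnorm (vec r z)) \<cdot>\<^sub>v vec r z) $ i) \<in> borel_measurable (uniform_measure ?P ?S)"
      using i by (simp add: measurable_cong_sets[OF sets_uniform_measure refl])
  qed simp
  then show ?thesis unfolding uniform_sphere_def by (rule U.prob_space_distr)
qed

lemma elliptical_prob_space:
  assumes "elliptical p P \<Sigma> \<xi>"
  shows "prob_space P" "sets P = sets (borel_vec p)"
proof -
  from assms obtain r A where \<xi>: "prob_space \<xi>" "sets \<xi> = sets borel"
    and r: "1 \<le> r" and A: "A \<in> carrier_mat p r"
    and P: "P = distr (\<xi> \<Otimes>\<^sub>M uniform_sphere r) (borel_vec p) (\<lambda>(s, w). s \<cdot>\<^sub>v (A *\<^sub>v w))"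
    unfolding elliptical_def by blast
  show "sets P = sets (borel_vec p)" by (simp add: P)
  have sU: "sets (uniform_sphere r) = sets (borel_vec r)" by (simp add: uniform_sphere_def)
  interpret \<xi>: prob_space \<xi> by fact
  interpret U: prob_space "uniform_sphere r" by (rule prob_space_uniform_sphere[OF r])
  interpret PP: pair_prob_space \<xi> "uniform_sphere r" ..
  have "(\<lambda>(s, w). s \<cdot>\<^sub>v (A *\<^sub>v w)) \<in> measurable (\<xi> \<Otimes>\<^sub>M uniform_sphere r) (borel_vec p)"
  proof (rule measurable_into_borel_vec)
    fix x assume "x \<in> space (\<xi> \<Otimes>\<^sub>M uniform_sphere r)"
    show "(case x of (s, w) \<Rightarrow> s \<cdot>\<^sub>v (A *\<^sub>v w)) \<in> carrier_vec p"
      using A by (cases x) (auto intro!: carrier_vecI)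
  next
    fix i assume i: "i < p"
    have 1: "fst \<in> borel_measurable (\<xi> \<Otimes>\<^sub>M uniform_sphere r)"
      using measurable_fst[of \<xi> "uniform_sphere r"] by (simp only: measurable_cong_sets[OF refl \<xi>(2)])
    have "(\<lambda>w. row A i \<bullet> w) \<in> borel_measurable (uniform_sphere r)"
      using measurable_scalar_prod[of "row A i" r] by (simp only: measurable_cong_sets[OF sU refl])
    then have "(\<lambda>x. row A i \<bullet> snd x) \<in> borel_measurable (\<xi> \<Otimes>\<^sub>M uniform_sphere r)"
      by (rule measurable_compose[OF measurable_snd])
    then have "(\<lambda>x. fst x * (row A i \<bullet> snd x)) \<in> borel_measurable (\<xi> \<Otimes>\<^sub>M uniform_sphere r)"
      using 1 by (rule borel_measurable_times[rotated])
    also have "(\<lambda>x. fst x * (row A i \<bullet> snd x)) = (\<lambda>x. (case x of (s, w) \<Rightarrow> s \<cdot>\<^sub>v (A *\<^sub>v w)) $ i)"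
      using A i by (auto simp: fun_eq_iff)
    finally show "(\<lambda>x. (case x of (s, w) \<Rightarrow> s \<cdot>\<^sub>v (A *\<^sub>v w)) $ i) \<in> borel_measurable (\<xi> \<Otimes>\<^sub>M uniform_sphere r)" .
  qed
  then show "prob_space P" unfolding P by (rule PP.prob_space_distr)
qed

lemma contaminated_mixture:
  assumes P: "prob_space P" and Q: "prob_space Q" and sets: "sets Q = sets P"
    and \<epsilon>: "0 \<le> \<epsilon>" "\<epsilon> \<le> 1"
  shows "prob_space (contaminated \<epsilon> P Q)" "sets (contaminated \<epsilon> P Q) = sets P"
    "B \<in> sets P \<Longrightarrow> measure (contaminated \<epsilon> P Q) B = (1 - \<epsilon>) * measure P B + \<epsilon> * measure Q B"
proof -
  interpret P: prob_space P by fact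
  interpret Q: prob_space Q by fact
  let ?f = "\<lambda>B. ennreal (1 - \<epsilon>) * emeasure P B + ennreal \<epsilon> * emeasure Q B"
  show s: "sets (contaminated \<epsilon> P Q) = sets P"
    unfolding contaminated_def by simp
  have em: "emeasure (contaminated \<epsilon> P Q) B = ?f B" if "B \<in> sets P" for B
    unfolding contaminated_def
  proof (rule emeasure_measure_of_sigma[OF sets.sigma_algebra_axioms _ _ that])
    show "positive (sets P) ?f" by (simp add: positive_def)
    show "countably_additive (sets P) ?f"
    proof (rule countably_additiveI)
      fix A :: "nat \<Rightarrow> 'a set" assume A: "range A \<subseteq> sets P" "disjoint_family A"
      have "(\<Sum>i. ?f (A i)) = (\<Sum>i. ennreal (1 - \<epsilon>) * emeasure P (A i)) + (\<Sum>i. ennreal \<epsilon> * emeasure Q (A i))"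
        by (rule suminf_add[symmetric]) auto
      also have "\<dots> = ?f (\<Union>i. A i)"
        using A sets by (simp add: suminf_emeasure)
      finally show "(\<Sum>i. ?f (A i)) = ?f (\<Union>i. A i)" .
    qed
  qed
  have em': "emeasure (contaminated \<epsilon> P Q) B = ennreal ((1 - \<epsilon>) * measure P B + \<epsilon> * measure Q B)"
    if "B \<in> sets P" for B
    unfolding em[OF that] P.emeasure_eq_measure Q.emeasure_eq_measure
    using \<epsilon> by (simp add: ennreal_plus ennreal_mult)
  show "measure (contaminated \<epsilon> P Q) B = (1 - \<epsilon>) * measure P B + \<epsilon> * measure Q B" if "B \<in> sets P"
    unfolding measure_def em'[OF that] using \<epsilon> by (intro enn2real_ennreal) (auto simp flip: measure_def)
  have sp: "space (contaminated \<epsilon> P Q) = space P" using sets_eq_imp_space_eq[OF s] .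
  have "space Q = space P" using sets_eq_imp_space_eq[OF sets] .
  then have "measure Q (space P) = 1" using Q.prob_space by simp
  then show "prob_space (contaminated \<epsilon> P Q)"
    by (intro prob_spaceI) (simp add: sp em' P.prob_space)
qed

section \<open>Error of the deepest scatter matrix\<close>

text \<open>
  If \<open>u\<^sup>T \<Gamma> u\<close> were 0, the quotient in \<open>G_fun\<close> would be 0 by the convention for division, and \<open>G_fun\<close> at 1 would
  be the total mass 1 instead of 1/2.
\<close>

lemma quadratic_form_pos:
  assumes P: "prob_space P" "sets P = sets (borel_vec p)" and \<Gamma>: "psd p \<Gamma>"
    and u: "u \<in> unit_sphere p" and half: "G_fun p P \<Gamma> u 1 = 1 / 2"
  shows "0 < u \<bullet> (\<Gamma> *\<^sub>v u)"
proof (rule ccontr)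
  assume "\<not> ?thesis"
  moreover have "0 \<le> u \<bullet> (\<Gamma> *\<^sub>v u)" using \<Gamma> u by (auto simp: psd_def unit_sphere_iff)
  ultimately have "u \<bullet> (\<Gamma> *\<^sub>v u) = 0" by simp
  then have "G_fun p P \<Gamma> u 1 = measure P (space P)"
    using sets_eq_imp_space_eq[OF P(2)] by (simp add: G_fun_def)
  then show False using half prob_space.prob_space[OF P(1)] by simp
qed

text \<open>
  The first infimum of the marginal condition excludes \<open>|t| \<ge> \<alpha>\<close>; for the remaining \<open>t\<close> the second one is a
  lower bound on the slope of \<open>G_fun\<close> at 1.
\<close>

lemma marginal_condition_deviation:
  assumes mc: "marginal_condition p P \<Gamma> \<tau> \<alpha> \<kappa>" and u: "u \<in> unit_sphere p"
    and dev: "\<bar>G_fun p P \<Gamma> u 1 - G_fun p P \<Gamma> u (1 + t)\<bar> \<le> \<beta>" and \<beta>: "\<beta> < \<tau>" and t: "t \<noteq> 0"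
  shows "\<bar>t\<bar> \<le> \<beta> * sqrt \<kappa>"
proof -
  let ?G = "G_fun p P \<Gamma> u"
  have k: "0 < \<kappa>" and far: "\<tau> \<le> (INF t\<in>{t. \<alpha> \<le> \<bar>t\<bar>}. \<bar>?G 1 - ?G (1 + t)\<bar>)"
    and near: "\<kappa> powr (- 1 / 2) \<le> (INF t\<in>{t. 0 < \<bar>t\<bar> \<and> \<bar>t\<bar> < \<alpha>}. \<bar>?G 1 - ?G (1 + t)\<bar> / \<bar>t\<bar>)"
    using mc u unfolding marginal_condition_def by (auto simp: Let_def)
  have less: "\<bar>t\<bar> < \<alpha>"
  proof (rule ccontr)
    assume "\<not> \<bar>t\<bar> < \<alpha>"
    then have "(INF t\<in>{t. \<alpha> \<le> \<bar>t\<bar>}. \<bar>?G 1 - ?G (1 + t)\<bar>) \<le> \<bar>?G 1 - ?G (1 + t)\<bar>"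
      by (intro cINF_lower bdd_belowI2[where m = 0]) auto
    then show False using far dev \<beta> by linarith
  qed
  have "(INF t\<in>{t. 0 < \<bar>t\<bar> \<and> \<bar>t\<bar> < \<alpha>}. \<bar>?G 1 - ?G (1 + t)\<bar> / \<bar>t\<bar>) \<le> \<bar>?G 1 - ?G (1 + t)\<bar> / \<bar>t\<bar>"
    using less t by (intro cINF_lower bdd_belowI2[where m = 0]) auto
  also have "\<dots> \<le> \<beta> / \<bar>t\<bar>" using dev t by (intro divide_right_mono) auto
  finally have "\<kappa> powr (- 1 / 2) \<le> \<beta> / \<bar>t\<bar>" using near by linarith
  moreover have "\<kappa> powr (- 1 / 2) = 1 / sqrt \<kappa>"
    using k by (simp add: powr_half_sqrt powr_minus_divide flip: minus_divide_left)
  ultimately have "1 / sqrt \<kappa> \<le> \<beta> / \<bar>t\<bar>" by simp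
  then show "\<bar>t\<bar> \<le> \<beta> * sqrt \<kappa>" using k t by (simp add: field_simps)
qed

text \<open>
  The deterministic part: on any sample where slabs and their exteriors have frequencies within \<open>r\<close> of
  their contaminated probabilities, a matrix at least as deep as \<open>\<Gamma>\<close> is close to \<open>\<Gamma>\<close>.
\<close>

lemma scatter_error_from_depth:
  assumes P: "prob_space P" "sets P = sets (borel_vec p)"
    and Q: "prob_space Q" "sets Q = sets (borel_vec p)"
    and \<epsilon>: "0 \<le> \<epsilon>" "\<epsilon> < 1" and p: "1 \<le> p" and n: "1 \<le> n"
    and \<Gamma>: "psd p \<Gamma>" "s_max \<Gamma> \<le> M" and half: "\<And>u. u \<in> unit_sphere p \<Longrightarrow> G_fun p P \<Gamma> u 1 = 1 / 2"
    and mc: "marginal_condition p P \<Gamma> \<tau> \<alpha> \<kappa>"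
    and Gh: "psd p Gh" "matrix_depth p n X \<Gamma> \<le> matrix_depth p n X Gh"
    and X: "\<And>i. i < n \<Longrightarrow> X i \<in> carrier_vec p"
    and le: "\<And>u q. u \<in> carrier_vec p \<Longrightarrow> 0 \<le> q \<Longrightarrow>
        count_dev n (contaminated \<epsilon> P Q) X {x\<in>carrier_vec p. (u \<bullet> x)\<^sup>2 \<le> q} \<le> n * r"
    and ge: "\<And>u q. u \<in> carrier_vec p \<Longrightarrow> 0 \<le> q \<Longrightarrow>
        count_dev n (contaminated \<epsilon> P Q) X {x\<in>carrier_vec p. q \<le> (u \<bullet> x)\<^sup>2} \<le> n * r"
    and \<beta>: "\<beta> = (2 * r + \<epsilon>) / (1 - \<epsilon>)" "\<beta> < \<tau>" and M: "0 < M"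
  shows "(op_norm (Gh - \<Gamma>))\<^sup>2 \<le> M\<^sup>2 * \<kappa> * \<beta>\<^sup>2"
proof -
  let ?N = "contaminated \<epsilon> P Q"
  interpret P: prob_space P by fact
  interpret Q: prob_space Q by fact
  have sQP: "sets Q = sets P" using P Q by simp
  have spP: "space P = carrier_vec p" using sets_eq_imp_space_eq[OF P(2)] by simp
  have N: "measure ?N B = (1 - \<epsilon>) * measure P B + \<epsilon> * measure Q B" if "B \<in> sets P" for B
    using contaminated_mixture(3)[OF P(1) Q(1) sQP] \<epsilon> that by simp
  let ?L = "\<lambda>u q. {x\<in>carrier_vec p. (u \<bullet> x)\<^sup>2 \<le> q}" and ?U = "\<lambda>u q. {x\<in>carrier_vec p. q \<le> (u \<bullet> x)\<^sup>2}"
  have Ls: "?L u q \<in> sets P" for u q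
    by (rule sets_scalar_prod_pred[OF P(2), where P = "\<lambda>s. s\<^sup>2 \<le> q"]) measurable
  have Us: "?U u q \<in> sets P" for u q
    by (rule sets_scalar_prod_pred[OF P(2), where P = "\<lambda>s. q \<le> s\<^sup>2"]) measurable
  have Nlow: "(1 - \<epsilon>) * measure P B \<le> measure ?N B" if "B \<in> sets P" for B
    using N[OF that] \<epsilon> by simp
  have Nup: "measure ?N B \<le> (1 - \<epsilon>) * measure P B + \<epsilon>" if "B \<in> sets P" for B
    using N[OF that] \<epsilon> Q.prob_le_1[of B] by (simp add: mult_left_le)
  have freq: "\<bar>(\<Sum>i<n. of_bool (R (X i))) / n - measure ?N {x\<in>carrier_vec p. R x}\<bar> \<le> r"
    if "count_dev n ?N X {x\<in>carrier_vec p. R x} \<le> n * r" for R :: "real vec \<Rightarrow> bool"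
  proof -
    have "(\<Sum>i<n. indicator {x\<in>carrier_vec p. R x} (X i)) = (\<Sum>i<n. of_bool (R (X i)) :: real)"
      using X by (intro sum.cong) (auto simp: indicator_def)
    then have "\<bar>(\<Sum>i<n. of_bool (R (X i))) - n * measure ?N {x\<in>carrier_vec p. R x}\<bar> \<le> n * r"
      using that by (simp add: count_dev_def)
    then have "\<bar>(\<Sum>i<n. of_bool (R (X i))) - n * measure ?N {x\<in>carrier_vec p. R x}\<bar> / n \<le> r"
      using n by (simp add: field_simps)
    also have "\<bar>(\<Sum>i<n. of_bool (R (X i))) - n * measure ?N {x\<in>carrier_vec p. R x}\<bar> / n
        = \<bar>((\<Sum>i<n. of_bool (R (X i))) - n * measure ?N {x\<in>carrier_vec p. R x}) / n\<bar>"
      by simp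
    also have "((\<Sum>i<n. of_bool (R (X i))) - n * measure ?N {x\<in>carrier_vec p. R x}) / n
        = (\<Sum>i<n. of_bool (R (X i))) / n - measure ?N {x\<in>carrier_vec p. R x}"
      using n by (simp add: diff_divide_distrib)
    finally show ?thesis .
  qed
  let ?FL = "\<lambda>u q. (\<Sum>i<n. of_bool ((u \<bullet> X i)\<^sup>2 \<le> q)) / real n"
  let ?FU = "\<lambda>u q. (\<Sum>i<n. of_bool (q \<le> (u \<bullet> X i)\<^sup>2)) / real n"
  have fL: "\<bar>?FL u q - measure ?N (?L u q)\<bar> \<le> r" and fU: "\<bar>?FU u q - measure ?N (?U u q)\<bar> \<le> r"
    if "u \<in> carrier_vec p" "0 \<le> q" for u q
    using freq[OF le[OF that]] freq[OF ge[OF that]] .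
  have depth: "matrix_depth p n X G = (INF u\<in>unit_sphere p. min (?FL u (u \<bullet> (G *\<^sub>v u))) (?FU u (u \<bullet> (G *\<^sub>v u))))" for G
    by (simp add: matrix_depth_def)
  have ne: "unit_sphere p \<noteq> {}" using unit_vec_in_unit_sphere[OF p] by auto
  have nonneg: "0 \<le> u \<bullet> (G *\<^sub>v u)" if "psd p G" "u \<in> unit_sphere p" for G u
    using that by (auto simp: psd_def unit_sphere_iff)
  have gpos: "0 < u \<bullet> (\<Gamma> *\<^sub>v u)" if "u \<in> unit_sphere p" for u
    by (rule quadratic_form_pos[OF P \<Gamma>(1) that half[OF that]])
  have G_eq: "G_fun p P \<Gamma> u t = measure P (?L u (t * (u \<bullet> (\<Gamma> *\<^sub>v u))))" if "u \<in> unit_sphere p" for u t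
    unfolding G_fun_def using gpos[OF that] by (simp add: divide_le_eq)
  have true_depth: "(1 - \<epsilon>) / 2 - r \<le> matrix_depth p n X \<Gamma>"
    unfolding depth
  proof (rule cINF_greatest[OF ne])
    fix u assume u: "u \<in> unit_sphere p"
    then have uc: "u \<in> carrier_vec p" by (simp add: unit_sphere_iff)
    define g where "g = u \<bullet> (\<Gamma> *\<^sub>v u)"
    have g: "0 \<le> g" using gpos[OF u] by (simp add: g_def)
    have L: "measure P (?L u g) = 1 / 2" using half[OF u] G_eq[OF u, of 1] by (simp add: g_def)
    have "?L u g \<union> ?U u g = space P" by (auto simp: spP)
    then have "1 \<le> measure P (?L u g) + measure P (?U u g)"
      using measure_Un_le[OF Ls[of u g] Us[of g u]] P.prob_space by simp
    then have U: "1 / 2 \<le> measure P (?U u g)" using L by simp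
    have "(1 - \<epsilon>) * (1 / 2) \<le> (1 - \<epsilon>) * measure P (?U u g)"
      using U \<epsilon> by (intro mult_left_mono) auto
    then have "(1 - \<epsilon>) / 2 \<le> measure ?N (?U u g)" using Nlow[OF Us[of g u]] by simp
    moreover have "(1 - \<epsilon>) / 2 \<le> measure ?N (?L u g)" using Nlow[OF Ls[of u g]] L by simp
    ultimately have "(1 - \<epsilon>) / 2 - r \<le> ?FL u g" "(1 - \<epsilon>) / 2 - r \<le> ?FU u g"
      using fL[OF uc g] fU[OF uc g] by linarith+
    then show "(1 - \<epsilon>) / 2 - r \<le> min (?FL u (u \<bullet> (\<Gamma> *\<^sub>v u))) (?FU u (u \<bullet> (\<Gamma> *\<^sub>v u)))"
      by (simp add: g_def)
  qed
  \<comment> \<open>From depth to mass: \<open>Gh\<close> inherits the depth of \<open>\<Gamma>\<close>; another \<open>r\<close> and the contamination \<open>\<epsilon>\<close> are lost on the way back to \<open>P\<close>.\<close>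
  have deep: "1 / 2 - \<beta> \<le> measure P (?L u (u \<bullet> (Gh *\<^sub>v u)))" "1 / 2 - \<beta> \<le> measure P (?U u (u \<bullet> (Gh *\<^sub>v u)))"
    if u: "u \<in> unit_sphere p" for u
  proof -
    define g where "g = u \<bullet> (Gh *\<^sub>v u)"
    have g: "0 \<le> g" using nonneg[OF Gh(1) u] by (simp add: g_def)
    have uc: "u \<in> carrier_vec p" using u by (simp add: unit_sphere_iff)
    have "matrix_depth p n X Gh \<le> min (?FL u g) (?FU u g)"
      unfolding depth g_def
      by (intro cINF_lower[OF bdd_belowI2[where m = 0] u]) (auto intro!: divide_nonneg_nonneg sum_nonneg)
    then have "(1 - \<epsilon>) / 2 - r \<le> ?FL u g" "(1 - \<epsilon>) / 2 - r \<le> ?FU u g"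
      using true_depth Gh(2) by auto
    then have NL: "(1 - \<epsilon>) / 2 - 2 * r \<le> (1 - \<epsilon>) * measure P (?L u g) + \<epsilon>"
      and NU: "(1 - \<epsilon>) / 2 - 2 * r \<le> (1 - \<epsilon>) * measure P (?U u g) + \<epsilon>"
      using fL[OF uc g] fU[OF uc g] Nup[OF Ls[of u g]] Nup[OF Us[of g u]] by linarith+
    have "1 / 2 - \<beta> \<le> m" if "(1 - \<epsilon>) / 2 - 2 * r \<le> (1 - \<epsilon>) * m + \<epsilon>" for m
      using that \<epsilon> unfolding \<beta>(1) by (simp add: field_simps)
    from this[OF NL] this[OF NU]
    show "1 / 2 - \<beta> \<le> measure P (?L u (u \<bullet> (Gh *\<^sub>v u)))" "1 / 2 - \<beta> \<le> measure P (?U u (u \<bullet> (Gh *\<^sub>v u)))"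
      by (simp_all add: g_def)
  qed
  have "0 \<le> real n * r"
    by (rule order_trans[OF _ le[of "0\<^sub>v p" 0]]) (simp_all add: count_dev_def)
  then have r0: "0 \<le> r" using n by (simp add: zero_le_mult_iff)
  have \<beta>0: "0 \<le> \<beta>" using r0 \<epsilon> by (simp add: \<beta>(1))
  have k0: "0 < \<kappa>" using mc by (simp add: marginal_condition_def)
  have quad: "\<bar>u \<bullet> ((Gh - \<Gamma>) *\<^sub>v u)\<bar> \<le> M * (\<beta> * sqrt \<kappa>)" if u: "u \<in> unit_sphere p" for u
  proof -
    define g where "g = u \<bullet> (\<Gamma> *\<^sub>v u)"
    define gh where "gh = u \<bullet> (Gh *\<^sub>v u)"
    have g: "0 < g" using gpos[OF u] by (simp add: g_def)
    define t where "t = gh / g - 1"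
    have gt: "(1 + t) * g = gh" using g by (simp add: t_def)
    have Gle: "G_fun p P \<Gamma> u s = measure P (?L u (s * g))" for s
      using G_eq[OF u] by (simp add: g_def)
    have mono: "G_fun p P \<Gamma> u s \<le> G_fun p P \<Gamma> u s'" if "s \<le> s'" for s s'
    proof -
      have "s * g \<le> s' * g" using that g by simp
      then have "?L u (s * g) \<subseteq> ?L u (s' * g)" by auto
      then show ?thesis unfolding Gle by (intro P.finite_measure_mono Ls)
    qed
    have tb: "\<bar>t\<bar> \<le> \<beta> * sqrt \<kappa>"
    proof (cases t "0 :: real" rule: linorder_cases)
      case less
      have "1 / 2 - \<beta> \<le> G_fun p P \<Gamma> u (1 + t)" unfolding Gle gt using deep(1)[OF u] by (simp add: gh_def)
      then have "\<bar>G_fun p P \<Gamma> u 1 - G_fun p P \<Gamma> u (1 + t)\<bar> \<le> \<beta>"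
        using mono[of "1 + t" 1] less half[OF u] by simp
      then show ?thesis using marginal_condition_deviation[OF mc u _ \<beta>(2)] less by blast
    next
      case equal
      then show ?thesis using \<beta>0 k0 by simp
    next
      case greater
      \<comment> \<open>The mass of \<open>?U u gh\<close> bounds \<open>G_fun\<close> only strictly below \<open>1 + t\<close>, hence the intermediate point \<open>s\<close>.\<close>
      show ?thesis
      proof (rule ccontr)
        assume "\<not> ?thesis"
        then have "\<beta> * sqrt \<kappa> < t" using greater by simp
        moreover have "0 \<le> \<beta> * sqrt \<kappa>" using \<beta>0 k0 by simp
        ultimately obtain s where s: "\<beta> * sqrt \<kappa> < s" "s < t" "0 < s"
          using dense[of "\<beta> * sqrt \<kappa>" t] by (meson le_less_trans)
        have "(1 + s) * g < gh" using s g unfolding gt[symmetric] by simp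
        then have "?L u ((1 + s) * g) \<inter> ?U u gh = {}" by auto
        then have "measure P (?L u ((1 + s) * g)) + measure P (?U u gh)
            = measure P (?L u ((1 + s) * g) \<union> ?U u gh)"
          by (intro P.finite_measure_Union[symmetric] Ls Us)
        also have "\<dots> \<le> 1" by simp
        finally have "G_fun p P \<Gamma> u (1 + s) \<le> 1 / 2 + \<beta>"
          unfolding Gle using deep(2)[OF u] by (simp add: gh_def)
        then have "\<bar>G_fun p P \<Gamma> u 1 - G_fun p P \<Gamma> u (1 + s)\<bar> \<le> \<beta>"
          using mono[of 1 "1 + s"] s half[OF u] by simp
        then have "\<bar>s\<bar> \<le> \<beta> * sqrt \<kappa>"
          using marginal_condition_deviation[OF mc u _ \<beta>(2)] s by blast
        then show False using s by simp
      qed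
    qed
    have G: "Gh \<in> carrier_mat p p" "\<Gamma> \<in> carrier_mat p p" using Gh(1) \<Gamma>(1) by (auto simp: psd_def)
    have "u \<in> carrier_vec p" using u by (simp add: unit_sphere_iff)
    then have "u \<bullet> ((Gh - \<Gamma>) *\<^sub>v u) = gh - g"
      using G unfolding gh_def g_def
      by (simp add: minus_mult_distrib_mat_vec[OF G] scalar_prod_minus_distrib[of _ p])
    also have "\<bar>gh - g\<bar> = g * \<bar>t\<bar>"
    proof -
      have "gh - g = g * t" using gt by (simp add: algebra_simps)
      then show ?thesis using g by (simp add: abs_mult)
    qed
    also have "\<dots> \<le> M * (\<beta> * sqrt \<kappa>)"
      using tb g M quadratic_form_le_s_max[OF \<Gamma>(1) u] \<Gamma>(2) unfolding g_def[symmetric]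
      by (intro mult_mono) auto
    finally show ?thesis .
  qed
  have c: "Gh - \<Gamma> \<in> carrier_mat p p" using \<Gamma>(1) by (intro minus_carrier_mat) (simp add: psd_def)
  have \<Gamma>c: "\<Gamma> \<in> carrier_mat p p" using \<Gamma>(1) by (simp add: psd_def)
  have sym: "Gh - \<Gamma> = transpose_mat (Gh - \<Gamma>)"
  proof (rule eq_matI)
    have G: "Gh \<in> carrier_mat p p" "\<Gamma> \<in> carrier_mat p p" "Gh = transpose_mat Gh" "\<Gamma> = transpose_mat \<Gamma>"
      using Gh(1) \<Gamma>(1) by (auto simp: psd_def)
    fix i j assume "i < dim_row (transpose_mat (Gh - \<Gamma>))" "j < dim_col (transpose_mat (Gh - \<Gamma>))"
    then have ij: "i < p" "j < p" using c by auto
    have "Gh $$ (i, j) = transpose_mat Gh $$ (i, j)" "\<Gamma> $$ (i, j) = transpose_mat \<Gamma> $$ (i, j)"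
      using G by simp_all
    then have "Gh $$ (i, j) = Gh $$ (j, i)" "\<Gamma> $$ (i, j) = \<Gamma> $$ (j, i)"
      using G(1,2) ij by simp_all
    then show "(Gh - \<Gamma>) $$ (i, j) = transpose_mat (Gh - \<Gamma>) $$ (i, j)"
      using G(1,2) ij by simp
  qed (use \<Gamma>c in auto)
  have "(op_norm (Gh - \<Gamma>))\<^sup>2 \<le> (M * (\<beta> * sqrt \<kappa>))\<^sup>2"
    using op_norm_symmetric_le[OF c sym p quad] by (intro power_mono) auto
  also have "\<dots> = M\<^sup>2 * \<kappa> * \<beta>\<^sup>2" using k0 by (simp add: power_mult_distrib)
  finally show ?thesis .
qed

text \<open>
  Arithmetic of the constants: \<open>\<epsilon> < \<tau>/3 < 1/6\<close> makes \<open>1/(1 - \<epsilon>)\<close> at most 6/5 and leaves, in \<open>\<beta> < \<tau>\<close>,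
  a margin \<open>\<tau>/2\<close> for \<open>2 r\<close>; the condition on the sample size gives \<open>r < \<tau>/4\<close>.
\<close>

lemma rate_constants:
  fixes p n :: nat and \<epsilon> \<tau> L :: real
  assumes p: "1 \<le> p" and n: "1 \<le> n" and \<epsilon>: "0 \<le> \<epsilon>" "\<epsilon> < \<tau> / 3" and \<tau>: "0 < \<tau>" "\<tau> < 1 / 2"
    and L: "0 < L" and small: "2 * 10 ^ 6 / \<tau>\<^sup>2 * ((p + L) / n) < 1"
  defines "r \<equiv> 28 * sqrt (8 * real n * (5 * real (p + 1) + L)) / n"
  defines "\<beta> \<equiv> (2 * r + \<epsilon>) / (1 - \<epsilon>)"
  shows "\<beta> < \<tau>" "\<beta>\<^sup>2 \<le> 10 ^ 6 * (max (p / n) (\<epsilon>\<^sup>2) + L / n)"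
proof -
  define x where "x = (p + L) / n"
  have x0: "0 < x" using p n L by (auto simp: x_def intro!: divide_pos_pos add_pos_pos)
  have r0: "0 \<le> r" using L by (simp add: r_def)
  have n0: "0 < real n" using n by simp
  have "r\<^sup>2 = 784 * (8 * real n * (5 * real (p + 1) + L)) / (real n)\<^sup>2"
    using L by (simp add: r_def power_divide power_mult_distrib)
  also have "\<dots> = 6272 * ((5 * real (p + 1) + L) / n)" using n by (simp add: power2_eq_square)
  also have "\<dots> \<le> 6272 * (10 * (p + L) / n)"
    using p L n0 by (intro mult_left_mono divide_right_mono) auto
  finally have r2: "r\<^sup>2 \<le> 62720 * x" by (simp add: x_def)
  have "2 * 10 ^ 6 * x / \<tau>\<^sup>2 < 1" using small by (simp add: x_def mult.commute)
  moreover have "0 < \<tau>\<^sup>2" using \<tau> by simp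
  ultimately have "2 * 10 ^ 6 * x < \<tau>\<^sup>2" by (simp only: divide_less_eq_1_pos)
  then have "r\<^sup>2 < (\<tau> / 4)\<^sup>2" using r2 x0 by (simp add: power_divide)
  then have rt: "r < \<tau> / 4" using \<tau> by (intro power_less_imp_less_base[of r 2]) auto
  have e1: "5 / 6 \<le> 1 - \<epsilon>" using \<epsilon> \<tau> by simp
  have "2 * r + \<epsilon> < \<tau> * (1 - \<epsilon>)"
  proof -
    have "\<tau> * (5 / 6) \<le> \<tau> * (1 - \<epsilon>)" using e1 \<tau> by (intro mult_left_mono) auto
    then show ?thesis using rt \<epsilon> by linarith
  qed
  then show "\<beta> < \<tau>" using e1 by (simp add: \<beta>_def field_simps)
  have "\<beta> \<le> (2 * r + \<epsilon>) / (5 / 6)" unfolding \<beta>_def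
    using e1 r0 \<epsilon> by (intro divide_left_mono) auto
  then have "\<beta>\<^sup>2 \<le> ((2 * r + \<epsilon>) / (5 / 6))\<^sup>2"
    using r0 \<epsilon> e1 by (intro power_mono) (auto simp: \<beta>_def)
  also have "\<dots> = 36 / 25 * (2 * r + \<epsilon>)\<^sup>2"
  proof -
    have "(y / (5 / 6))\<^sup>2 = 36 / 25 * y\<^sup>2" for y :: real by (simp add: power2_eq_square)
    then show ?thesis .
  qed
  also have "(2 * r + \<epsilon>)\<^sup>2 \<le> 8 * r\<^sup>2 + 2 * \<epsilon>\<^sup>2"
    using sum_squares_ge_zero[of "2 * r - \<epsilon>" 0] by (simp add: power2_eq_square algebra_simps)
  finally have b: "\<beta>\<^sup>2 \<le> 36 / 25 * (8 * (62720 * x) + 2 * \<epsilon>\<^sup>2)" using r2 by simp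
  define m where "m = max (p / n) (\<epsilon>\<^sup>2)"
  have m: "p / n \<le> m" "\<epsilon>\<^sup>2 \<le> m" by (auto simp: m_def)
  have "x \<le> m + L / n" using m(1) by (simp add: x_def add_divide_distrib)
  moreover have "\<epsilon>\<^sup>2 \<le> m + L / n" using m(2) L by (simp add: add_increasing2)
  moreover have "0 \<le> m + L / n" using x0 calculation(1) by simp
  ultimately have "\<beta>\<^sup>2 \<le> 10 ^ 6 * (m + L / n)" using b by simp
  then show "\<beta>\<^sup>2 \<le> 10 ^ 6 * (max (p / n) (\<epsilon>\<^sup>2) + L / n)" by (simp add: m_def)
qed

theorem theorem4p1:
  fixes M :: real
  assumes "0 < M"
  shows "\<exists>C>0. \<forall>\<tau>::real. 0 < \<tau> \<and> \<tau> < 1 / 2 \<longrightarrow>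
    (\<exists>C1>0. \<forall>(p::nat) (n::nat) (\<epsilon>::real) (\<alpha>::real) (\<kappa>::real) (\<delta>::real) Gh.
      1 \<le> p \<and> 1 \<le> n \<and> 0 \<le> \<epsilon> \<and> \<epsilon> < \<tau> / 3 \<and> 0 < \<delta> \<and> \<delta> < 1 / 2 \<and>
      C1 * ((real p + ln (1 / \<delta>)) / real n) < 1 \<and>
      deepest_estimator p n Gh \<longrightarrow>
      (\<forall>\<Gamma>\<in>cov_class p M. \<forall>P \<eta> Q.
        canonical_EC p P \<Gamma> \<eta> \<and> marginal_condition p P \<Gamma> \<tau> \<alpha> \<kappa> \<and>
        prob_space Q \<and> sets Q = sets (borel_vec p) \<longrightarrow>
        with_prob_at_least (iid_law n (contaminated \<epsilon> P Q)) (1 - 2 * \<delta>)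
          (\<lambda>X. (op_norm (Gh X - \<Gamma>))\<^sup>2
             \<le> C * \<kappa> * (max (real p / real n) (\<epsilon>\<^sup>2) + ln (1 / \<delta>) / real n))))"
proof (rule exI[of _ "M\<^sup>2 * 10 ^ 6"], intro conjI allI impI)
  show "0 < M\<^sup>2 * 10 ^ 6" using assms by simp
  fix \<tau> :: real assume \<tau>: "0 < \<tau> \<and> \<tau> < 1 / 2"
  show "\<exists>C1>0. \<forall>(p::nat) (n::nat) (\<epsilon>::real) (\<alpha>::real) (\<kappa>::real) (\<delta>::real) Gh.
      1 \<le> p \<and> 1 \<le> n \<and> 0 \<le> \<epsilon> \<and> \<epsilon> < \<tau> / 3 \<and> 0 < \<delta> \<and> \<delta> < 1 / 2 \<and>
      C1 * ((real p + ln (1 / \<delta>)) / real n) < 1 \<and>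
      deepest_estimator p n Gh \<longrightarrow>
      (\<forall>\<Gamma>\<in>cov_class p M. \<forall>P \<eta> Q.
        canonical_EC p P \<Gamma> \<eta> \<and> marginal_condition p P \<Gamma> \<tau> \<alpha> \<kappa> \<and>
        prob_space Q \<and> sets Q = sets (borel_vec p) \<longrightarrow>
        with_prob_at_least (iid_law n (contaminated \<epsilon> P Q)) (1 - 2 * \<delta>)
          (\<lambda>X. (op_norm (Gh X - \<Gamma>))\<^sup>2
             \<le> M\<^sup>2 * 10 ^ 6 * \<kappa> * (max (real p / real n) (\<epsilon>\<^sup>2) + ln (1 / \<delta>) / real n)))"
  proof (rule exI[of _ "2 * 10 ^ 6 / \<tau>\<^sup>2"], intro conjI allI impI ballI)
    show "0 < 2 * 10 ^ 6 / \<tau>\<^sup>2" using \<tau> by simp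
    fix p n :: nat and \<epsilon> \<alpha> \<kappa> \<delta> :: real and Gh \<Gamma> P \<eta> Q
    assume "1 \<le> p \<and> 1 \<le> n \<and> 0 \<le> \<epsilon> \<and> \<epsilon> < \<tau> / 3 \<and> 0 < \<delta> \<and> \<delta> < 1 / 2 \<and>
      2 * 10 ^ 6 / \<tau>\<^sup>2 * ((real p + ln (1 / \<delta>)) / real n) < 1 \<and> deepest_estimator p n Gh"
    then have p: "1 \<le> p" and n: "1 \<le> n" and \<epsilon>: "0 \<le> \<epsilon>" "\<epsilon> < \<tau> / 3" and \<delta>: "0 < \<delta>" "\<delta> < 1 / 2"
      and small: "2 * 10 ^ 6 / \<tau>\<^sup>2 * ((real p + ln (1 / \<delta>)) / real n) < 1"
      and Gh: "deepest_estimator p n Gh" by auto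
    assume "\<Gamma> \<in> cov_class p M"
    then have \<Gamma>: "psd p \<Gamma>" "s_max \<Gamma> \<le> M" by (auto simp: cov_class_def)
    assume "canonical_EC p P \<Gamma> \<eta> \<and> marginal_condition p P \<Gamma> \<tau> \<alpha> \<kappa> \<and>
        prob_space Q \<and> sets Q = sets (borel_vec p)"
    then have ec: "canonical_EC p P \<Gamma> \<eta>" and mc: "marginal_condition p P \<Gamma> \<tau> \<alpha> \<kappa>"
      and Q: "prob_space Q" "sets Q = sets (borel_vec p)" by auto
    from ec have ell: "elliptical p P \<Gamma> \<eta>" and half: "\<And>u. u \<in> unit_sphere p \<Longrightarrow> G_fun p P \<Gamma> u 1 = 1 / 2"
      by (auto simp: canonical_EC_def canonical_rep_of_def)
    have P: "prob_space P" "sets P = sets (borel_vec p)" using elliptical_prob_space[OF ell] by auto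
    have \<epsilon>1: "\<epsilon> \<le> 1" "\<epsilon> < 1" using \<epsilon> \<tau> by auto
    have sQP: "sets Q = sets P" using P Q by simp
    define N where "N = contaminated \<epsilon> P Q"
    have N: "prob_space N" "sets N = sets (borel_vec p)"
      unfolding N_def using contaminated_mixture(1,2)[OF P(1) Q(1) sQP \<epsilon>(1) \<epsilon>1(1)] P by auto
    have spN: "space N = carrier_vec p" using sets_eq_imp_space_eq[OF N(2)] by simp
    define L where "L = ln (1 / \<delta>)"
    have L: "0 < L" using \<delta> by (simp add: L_def)
    \<comment> \<open>Deviation \<open>t\<close> of half-space counts, twice that for slabs, and \<open>r = 2 t / n\<close> in frequencies.\<close>
    define t where "t = 14 * sqrt (8 * real n * (5 * real (p + 1) + L))"
    define r where "r = 28 * sqrt (8 * real n * (5 * real (p + 1) + L)) / n"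
    define \<beta> where "\<beta> = (2 * r + \<epsilon>) / (1 - \<epsilon>)"
    have nr: "n * r = 2 * t" using n by (simp add: r_def t_def)
    have bnds: "\<beta> < \<tau>" "\<beta>\<^sup>2 \<le> 10 ^ 6 * (max (p / n) (\<epsilon>\<^sup>2) + L / n)"
      using rate_constants[OF p n \<epsilon> _ _ L] \<tau> small unfolding \<beta>_def r_def L_def by auto
    let ?F = "rational_halfspaces p"
    have Fs: "?F \<subseteq> sets N"
      using sets_halfspace[OF N(2)] by (auto simp: rational_halfspaces_def)
    let ?D = "deviation_event n N ?F t" and ?W = "Pi\<^sub>M {..<n} (\<lambda>_. N)"
    interpret W: prob_space ?W by (intro prob_space_PiM N)
    have Ds: "?D \<in> sets ?W" by (rule sets_deviation_event[OF countable_rational_halfspaces Fs])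
    have "measure ?W ?D \<le> 2 * \<delta>"
      unfolding t_def L_def
      using vc_uniform_deviation[OF N(1) countable_rational_halfspaces Fs vc_dim_rational_halfspaces n] \<delta> by simp
    then have prob: "1 - 2 * \<delta> \<le> measure ?W (space ?W - ?D)" using W.prob_compl[OF Ds] by simp
    show "with_prob_at_least (iid_law n (contaminated \<epsilon> P Q)) (1 - 2 * \<delta>)
          (\<lambda>X. (op_norm (Gh X - \<Gamma>))\<^sup>2
             \<le> M\<^sup>2 * 10 ^ 6 * \<kappa> * (max (real p / real n) (\<epsilon>\<^sup>2) + ln (1 / \<delta>) / real n))"
      unfolding with_prob_at_least_def iid_law_def N_def[symmetric]
    proof (intro bexI[of _ "space ?W - ?D"] conjI ballI prob)
      show "space ?W - ?D \<in> sets ?W" using Ds by auto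
      fix X assume XE: "X \<in> space ?W - ?D"
      then have X: "X i \<in> carrier_vec p" if "i < n" for i
        using that by (auto simp: space_PiM PiE_iff spN)
      have rat: "count_dev n N X A \<le> t" if "A \<in> ?F" for A
        using XE that by (auto simp: deviation_event_def count_dev_def not_less)
      have halfs: "count_dev n N X (halfspace p u c) \<le> t" if "u \<in> carrier_vec p" for u c
        by (rule count_dev_halfspace_le[OF N X rat that])
      have slab: "count_dev n N X {x\<in>carrier_vec p. (u \<bullet> x)\<^sup>2 \<le> q} \<le> n * r"
        "count_dev n N X {x\<in>carrier_vec p. q \<le> (u \<bullet> x)\<^sup>2} \<le> n * r"
        if "u \<in> carrier_vec p" "0 \<le> q" for u q
        unfolding nr using count_dev_slab_le[OF N X halfs that] by auto
      have "is_arg_max (matrix_depth p n X) (psd p) (Gh X)"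
        using Gh X by (auto simp: deepest_estimator_def)
      then have GX: "psd p (Gh X)" "matrix_depth p n X \<Gamma> \<le> matrix_depth p n X (Gh X)"
        using \<Gamma>(1) by (auto simp: is_arg_max_def not_less)
      have "(op_norm (Gh X - \<Gamma>))\<^sup>2 \<le> M\<^sup>2 * \<kappa> * \<beta>\<^sup>2"
        by (rule scatter_error_from_depth[OF P Q \<epsilon>(1) \<epsilon>1(2) p n \<Gamma> half mc GX X
              slab[unfolded N_def] \<beta>_def bnds(1) assms])
      also have "\<dots> \<le> M\<^sup>2 * \<kappa> * (10 ^ 6 * (max (p / n) (\<epsilon>\<^sup>2) + L / n))"
        using mc by (intro mult_left_mono bnds(2)) (simp add: marginal_condition_def)
      also have "\<dots> = M\<^sup>2 * 10 ^ 6 * \<kappa> * (max (real p / real n) (\<epsilon>\<^sup>2) + ln (1 / \<delta>) / real n)"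
        by (simp add: L_def mult_ac)
      finally show "(op_norm (Gh X - \<Gamma>))\<^sup>2
          \<le> M\<^sup>2 * 10 ^ 6 * \<kappa> * (max (real p / real n) (\<epsilon>\<^sup>2) + ln (1 / \<delta>) / real n)" .
    qed
  qed
qed

end
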